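(* Suppose assumptions (I)–(III) of the context hold, and let $\{(x_k,y_k)\}_{k\ge0}$ be the sequence generated by the CG-RPGA algorithm described in the context with step-sizes $\tau_k=\tau>0$ and $\sigma_k=\sigma\le\frac{2}{L_{yy}+2\mu}$ (with $\sigma>0$), and parameter $\mu>0$. Choose $\mu=\mathcal O(\epsilon)$ and $\tau=\mathcal O(\epsilon^3)$. Then for any $K\ge1$ there exists $t\in\{\lceil K/2\rceil,\dots,K-1\}$ such that $(x_t,y_t)\in X\times Y$ satisfies $\mathcal G_Z(x_t,y_t)\le\mathcal O(1/K^{1/4})$. Moreover, $(x_t,y_t)$ satisfies $\mathcal G_Z(x_t,y_t)\le\epsilon$, and consequently is an $\epsilon$-game stationary point, within $\mathcal O(\epsilon^{-4})$ iterations.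
   Context: Setting. $(\mathcal X,\|\cdot\|_{\mathcal X})$ is a finite-dimensional real normed space with dual norm $\|\cdot\|_{\mathcal X^*}$; $\mathcal Y$ is a finite-dimensional real space equipped with the Euclidean norm $\|\cdot\|_{\mathcal Y}=\|\cdot\|_2$, and projection onto $Y$ is assumed efficiently computable. The problem is $\min_{x\in X}\max_{y\in Y}\mathcal L(x,y)$ with $\mathcal L:\mathcal X\times\mathcal Y\to\mathbb R$. Assumptions. (I) For any $y\in Y$, $\mathcal L(\cdot,y)$ (possibly nonconvex) is continuously differentiable, and there are $L_{xx}\ge0$, $L_{yx}>0$ with $\|\nabla_x\mathcal L(x,y)-\nabla_x\mathcal L(\bar x,\bar y)\|_{\mathcal X^*}\le L_{xx}\|x-\bar x\|_{\mathcal X}+L_{yx}\|y-\bar y\|_2$ for all $x,\bar x\in X$, $y,\bar y\in Y$. (II) For any $x\in X$, $\mathcal L(x,\cdot)$ is concave and continuously differentiable, and there are $L_{yy}\ge0$, $L_{yx}>0$ with $\|\nabla_y\mathcal L(x,y)-\nabla_y\mathcal L(\bar x,\bar y)\|_2\le L_{yx}\|x-\bar x\|_{\mathcal X}+L_{yy}\|y-\bar y\|_2$ for all $x,\bar x\in X$, $y,\bar y\in Y$. (III) $X\subseteq\mathcal X$, $Y\subseteq\mathcal Y$ are convex compact sets (with finite diameters $D_X$, $D_Y$ in the respective norms). Notation. $\mathcal P_Y$ is the Euclidean projection onto $Y$. Gap functions: $\mathcal G_X(\bar x,\bar y)=\sup_{x\in X}\langle\nabla_x\mathcal L(\bar x,\bar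 y),\bar x-x\rangle$, $\mathcal G_Y(\bar x,\bar y)=\frac1\sigma\|\bar y-\mathcal P_Y(\bar y+\sigma\nabla_y\mathcal L(\bar x,\bar y))\|_2$ with $\sigma$ the dual step-size, and $\mathcal G_Z=\mathcal G_X+\mathcal G_Y$. A point $(\bar x,\bar y)\in X\times Y$ is $\epsilon$-game stationary if $-\nabla_x\mathcal L(\bar x,\bar y)\in\partial\mathbb 1_X(\bar x)+u$ for some $u$ with $\|u\|_{\mathcal X}\le\mathcal O(\epsilon)$ and $\nabla_y\mathcal L(\bar x,\bar y)\in\partial\mathbb 1_Y(\bar y)+v$ for some $v$ with $\|v\|_{\mathcal Y}\le\mathcal O(\epsilon)$, where $\mathbb 1_X,\mathbb 1_Y$ are the indicator functions of $X,Y$ (value $0$ on the set and $+\infty$ off it) and $\partial$ is the subdifferential. CG-RPGA algorithm. Given $x_0\in X$, $y_0\in Y$, $\mu$, nonnegative step-sizes $\tau_k,\sigma_k$, for $k=0,1,\dots$: $s_k\in\operatorname{argmin}_{x\in X}\langle\nabla_x\mathcal L(x_k,y_k),x\rangle$; $x_{k+1}=\tau_ks_k+(1-\tau_k)x_k$; $y_{k+1}=\mathcal P_Y\big(y_k+\sigma_k(\nabla_y\mathcal L(x_k,y_k)-\mu(y_k-y_0))\big)$.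
   Formalization: x-stationarity uses the ε-subdifferential of 1_X (the exact one fails: X=[0,1], L=x), exact only if a ball about x_t lies in X; K≥2 (no t for K=1); τ≤1; rate O(K^{-1/4}) read with ε=K^{-1/4} and μ, τ of exact orders ε, ε³; G_Z≤ε for small enough constants. *)

theory Defs
  imports "HOL-Analysis.Analysis"
begin

(* Throughout, gx x y :: 'a =>L real is the gradient of L(.,y) at x as an element of the dual
   space, so its norm (the operator norm) is the dual norm and gx x y v is the pairing <gx x y, v>.
   gy x y :: 'b is the gradient of L(x,.) at y as a vector of the Euclidean space. *)

definition gap_X ::
  "'a::real_normed_vector set \<Rightarrow> ('a \<Rightarrow> 'b \<Rightarrow> 'a \<Rightarrow>\<^sub>L real) \<Rightarrow> 'a \<Rightarrow> 'b \<Rightarrow> real"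
  where "gap_X X gx x y = (SUP x'\<in>X. blinfun_apply (gx x y) (x - x'))"

definition gap_Y ::
  "'b::euclidean_space set \<Rightarrow> ('a \<Rightarrow> 'b \<Rightarrow> 'b) \<Rightarrow> real \<Rightarrow> 'a \<Rightarrow> 'b \<Rightarrow> real"
  where "gap_Y Y gy \<sigma> x y = (1 / \<sigma>) * norm (y - closest_point Y (y + \<sigma> *\<^sub>R gy x y))"

definition gap_Z ::
  "'a::real_normed_vector set \<Rightarrow> 'b::euclidean_space set \<Rightarrow> ('a \<Rightarrow> 'b \<Rightarrow> 'a \<Rightarrow>\<^sub>L real) \<Rightarrow>
   ('a \<Rightarrow> 'b \<Rightarrow> 'b) \<Rightarrow> real \<Rightarrow> 'a \<Rightarrow> 'b \<Rightarrow> real"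
  where "gap_Z X Y gx gy \<sigma> x y = gap_X X gx x y + gap_Y Y gy \<sigma> x y"

definition indicator_fn :: "'a set \<Rightarrow> 'a \<Rightarrow> ereal"
  where "indicator_fn S x = (if x \<in> S then 0 else \<infinity>)"

(* The eta-subdifferential; it is empty where f is not finite. *)
definition eps_subdifferential ::
  "real \<Rightarrow> ('a::real_normed_vector \<Rightarrow> ereal) \<Rightarrow> 'a \<Rightarrow> ('a \<Rightarrow>\<^sub>L real) set"
  where "eps_subdifferential \<eta> f x =
    {\<xi>. \<bar>f x\<bar> \<noteq> \<infinity> \<and> (\<forall>z. f x + ereal (blinfun_apply \<xi> (z - x)) \<le> f z + ereal \<eta>)}"

definition subdifferential ::
  "('a::real_normed_vector \<Rightarrow> ereal) \<Rightarrow> 'a \<Rightarrow> ('a \<Rightarrow>\<^sub>L real) set"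
  where "subdifferential f = eps_subdifferential 0 f"

(* Game stationarity with residuals bounded by delta. In the x-inclusion the subdifferential is
   replaced by the eta-subdifferential; eta = 0 is exact game stationarity (see below). The slack
   is needed because a small gap_X does not put - gx x y near the exact normal cone: for
   X = [0,1] and L x y = x, the gap at x > 0 is x, but the residual u at every x in (0,1) is -1.
   blinfun_inner_right identifies a vector of the Euclidean space with a functional. *)
definition approx_game_stationary ::
  "'a::real_normed_vector set \<Rightarrow> 'b::euclidean_space set \<Rightarrow> ('a \<Rightarrow> 'b \<Rightarrow> 'a \<Rightarrow>\<^sub>L real) \<Rightarrow>
   ('a \<Rightarrow> 'b \<Rightarrow> 'b) \<Rightarrow> real \<Rightarrow> real \<Rightarrow> 'a \<Rightarrow> 'b \<Rightarrow> bool"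
  where "approx_game_stationary X Y gx gy \<eta> \<delta> x y \<longleftrightarrow> x \<in> X \<and> y \<in> Y \<and>
    (\<exists>u. norm u \<le> \<delta> \<and> - gx x y \<in> {\<xi> + u |\<xi>. \<xi> \<in> eps_subdifferential \<eta> (indicator_fn X) x}) \<and>
    (\<exists>v. norm v \<le> \<delta> \<and> blinfun_inner_right (gy x y)
           \<in> {\<xi> + blinfun_inner_right v |\<xi>. \<xi> \<in> subdifferential (indicator_fn Y) y})"

definition game_stationary ::
  "'a::real_normed_vector set \<Rightarrow> 'b::euclidean_space set \<Rightarrow> ('a \<Rightarrow> 'b \<Rightarrow> 'a \<Rightarrow>\<^sub>L real) \<Rightarrow>
   ('a \<Rightarrow> 'b \<Rightarrow> 'b) \<Rightarrow> real \<Rightarrow> 'a \<Rightarrow> 'b \<Rightarrow> bool"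
  where "game_stationary X Y gx gy \<delta> x y \<longleftrightarrow> x \<in> X \<and> y \<in> Y \<and>
    (\<exists>u. norm u \<le> \<delta> \<and> - gx x y \<in> {\<xi> + u |\<xi>. \<xi> \<in> subdifferential (indicator_fn X) x}) \<and>
    (\<exists>v. norm v \<le> \<delta> \<and> blinfun_inner_right (gy x y)
           \<in> {\<xi> + blinfun_inner_right v |\<xi>. \<xi> \<in> subdifferential (indicator_fn Y) y})"

lemma game_stationary_iff_approx:
  "game_stationary X Y gx gy \<delta> x y \<longleftrightarrow> approx_game_stationary X Y gx gy 0 \<delta> x y"
  by (simp add: game_stationary_def approx_game_stationary_def subdifferential_def)

(* (xs, ys) is a run of CG-RPGA started at (xs 0, ys 0). The linear minimisation oracle may return
   any minimiser s k. *)
definition cg_rpga ::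
  "'a::real_normed_vector set \<Rightarrow> 'b::euclidean_space set \<Rightarrow> ('a \<Rightarrow> 'b \<Rightarrow> 'a \<Rightarrow>\<^sub>L real) \<Rightarrow>
   ('a \<Rightarrow> 'b \<Rightarrow> 'b) \<Rightarrow> real \<Rightarrow> (nat \<Rightarrow> real) \<Rightarrow> (nat \<Rightarrow> real) \<Rightarrow> (nat \<Rightarrow> 'a) \<Rightarrow> (nat \<Rightarrow> 'b) \<Rightarrow> bool"
  where "cg_rpga X Y gx gy \<mu> \<tau> \<sigma> xs ys \<longleftrightarrow> xs 0 \<in> X \<and> ys 0 \<in> Y \<and>
    (\<exists>s. \<forall>k.
      is_arg_min (\<lambda>x. blinfun_apply (gx (xs k) (ys k)) x) (\<lambda>x. x \<in> X) (s k) \<and>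
      xs (Suc k) = \<tau> k *\<^sub>R s k + (1 - \<tau> k) *\<^sub>R xs k \<and>
      ys (Suc k) = closest_point Y
        (ys k + \<sigma> k *\<^sub>R (gy (xs k) (ys k) - \<mu> *\<^sub>R (ys k - ys 0))))"

end

theory Submission
  imports Defs
begin

text \<open>For fixed \<open>x\<close> the regularized dual step is a contraction with factor \<open>1 - \<sigma> \<mu>\<close>, so
  \<open>ys k\<close> tracks its fixed point, the maximizer over \<open>Y\<close> of \<open>L x y - \<mu> / 2 * (norm (y - ys 0))\<^sup>2\<close>
  at \<open>x = xs k\<close>. This maximizer is \<open>Lyx / \<mu>\<close>-Lipschitz in \<open>x\<close>, hence the tracking error is
  \<open>O(1 / (K \<mu>) + \<tau> / \<mu>\<^sup>2)\<close> for all indices beyond \<open>K / 2\<close>, and it controls \<open>gap_Y\<close> up to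
  \<open>O(\<mu>)\<close>. The maximal value, as a function of \<open>x\<close>, decreases along the conditional gradient steps by
  \<open>\<tau> * gap_X\<close> up to errors; its oscillation on \<open>X\<close> is bounded independently of the parameters, so some
  index in the second half has \<open>gap_X = O(1 / (K \<tau>))\<close> plus the tracking error.

  The gradient of \<open>L x\<close> is Lipschitz only on \<open>Y\<close>, which may have empty interior, so the contraction does
  not follow from the usual cocoercivity inequality. Cocoercivity does hold for the tangential part of
  the gradient between nearby points of the relative interior; nonexpansiveness then propagates along
  segments by the triangle inequality and passes to the closure.\<close>

subsection \<open>Gradient steps on a convex set\<close>

lemma has_derivative_segment_mvt:
  fixes f :: "'a::real_normed_vector \<Rightarrow> real"
  assumes "\<And>u. u \<in> closed_segment x y \<Longrightarrow> (f has_derivative f' u) (at u)"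
  shows "\<exists>u\<in>closed_segment x y. f y - f x = f' u (y - x)"
proof -
  let ?u = "\<lambda>t::real. x + t *\<^sub>R (y - x)"
  have seg: "?u t \<in> closed_segment x y" if "0 \<le> t" "t \<le> 1" for t
    using that by (auto simp: in_segment algebra_simps intro!: exI[of _ t])
  have "\<exists>t\<in>{0..1}. f (?u 1) - f (?u 0) = f' (?u t) ((1 - 0) *\<^sub>R (y - x))"
  proof (rule mvt_very_simple)
    fix t :: real assume t: "0 \<le> t" "t \<le> 1"
    show "((\<lambda>t. f (?u t)) has_derivative (\<lambda>h. f' (?u t) (h *\<^sub>R (y - x)))) (at t within {0..1})"
      by (rule has_derivative_compose[where f="?u" and g=f and g'="f' (?u t)"])
        (use assms[OF seg[OF t]] in \<open>auto intro!: derivative_eq_intros\<close>)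
  qed simp
  then show ?thesis using seg by auto
qed

lemma GDERIV_along_line:
  assumes "GDERIV f (x + t *\<^sub>R d) :> g"
  shows "((\<lambda>t. f (x + t *\<^sub>R d)) has_real_derivative g \<bullet> d) (at t)"
proof -
  have "((\<lambda>t. f (x + t *\<^sub>R d)) has_derivative (\<lambda>h. (h *\<^sub>R d) \<bullet> g)) (at t)"
    by (rule has_derivative_compose[of "\<lambda>t. x + t *\<^sub>R d"])
      (use assms in \<open>auto simp: gderiv_def intro!: derivative_eq_intros\<close>)
  then show ?thesis
    by (simp add: has_field_derivative_def inner_commute mult.commute[of _ "d \<bullet> g"])
qed

text \<open>Along the line through \<open>x\<close> and \<open>y\<close>, the negative of
  \<open>f\<close> is a convex function of one real variable, so it lies above its tangent at
  0.\<close>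

lemma concave_on_UNIV_gradient_ge:
  fixes f :: "'a::real_inner \<Rightarrow> real"
  assumes "concave_on UNIV f" "GDERIV f x :> g"
  shows "f y \<le> f x + g \<bullet> (y - x)"
proof -
  let ?\<phi> = "\<lambda>t. - f (x + t *\<^sub>R (y - x))"
  have "convex_on UNIV ?\<phi>"
  proof (rule convex_onI)
    fix t u v :: real assume t: "0 < t" "t < 1"
    have eq: "x + ((1 - t) *\<^sub>R u + t *\<^sub>R v) *\<^sub>R (y - x)
        = (1 - t) *\<^sub>R (x + u *\<^sub>R (y - x)) + t *\<^sub>R (x + v *\<^sub>R (y - x))"
      by (simp add: algebra_simps)
    show "?\<phi> ((1 - t) *\<^sub>R u + t *\<^sub>R v) \<le> (1 - t) * ?\<phi> u + t * ?\<phi> v"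
      unfolding eq
      using convex_onD[OF assms(1)[unfolded concave_on_def], of t] t by simp
  qed simp
  moreover have "(?\<phi> has_real_derivative - (g \<bullet> (y - x))) (at 0)"
    by (intro DERIV_minus GDERIV_along_line) (use assms(2) in simp)
  ultimately have "?\<phi> 1 - ?\<phi> 0 \<ge> - (g \<bullet> (y - x)) * (1 - 0)"
    by (intro convex_on_imp_above_tangent[where A=UNIV]) auto
  then show ?thesis by simp
qed

text \<open>By the Lipschitz bound the directional derivative drops by at most
  \<open>K * t * (norm (y - x))\<^sup>2\<close> along the segment. The quadratic term in
  \<open>?\<phi>\<close> makes up for exactly this loss, so \<open>?\<phi>\<close> is
  nondecreasing.\<close>

lemma lipschitz_gradient_lower_bound:
  fixes f :: "'a::real_inner \<Rightarrow> real"
  assumes "convex S" "x \<in> S" "y \<in> S"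
    and grad: "\<And>u. u \<in> S \<Longrightarrow> GDERIV f u :> g u"
    and lip: "K-lipschitz_on S g"
  shows "f y \<ge> f x + g x \<bullet> (y - x) - K / 2 * (norm (y - x))\<^sup>2"
proof -
  let ?d = "y - x"
  let ?\<phi> = "\<lambda>t. f (x + t *\<^sub>R ?d) - t * (g x \<bullet> ?d) + K / 2 * t\<^sup>2 * (norm ?d)\<^sup>2"
  have "?\<phi> 0 \<le> ?\<phi> 1"
  proof (rule DERIV_nonneg_imp_nondecreasing[of 0 1 ?\<phi>])
    fix t :: real assume t: "0 \<le> t" "t \<le> 1"
    have mem: "x + t *\<^sub>R ?d \<in> S"
    proof -
      have "(1 - t) *\<^sub>R x + t *\<^sub>R y \<in> S" using assms t by (auto intro: convexD)
      then show ?thesis by (simp add: algebra_simps)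
    qed
    let ?D = "g (x + t *\<^sub>R ?d) \<bullet> ?d - g x \<bullet> ?d + K * t * (norm ?d)\<^sup>2"
    have "(?\<phi> has_real_derivative ?D) (at t)"
      by (rule derivative_eq_intros GDERIV_along_line[OF grad[OF mem]] refl | simp)+
    moreover have "?D \<ge> 0"
    proof -
      have "\<bar>(g (x + t *\<^sub>R ?d) - g x) \<bullet> ?d\<bar> \<le> norm (g (x + t *\<^sub>R ?d) - g x) * norm ?d"
        by (rule Cauchy_Schwarz_ineq2)
      also have "\<dots> \<le> (K * (t * norm ?d)) * norm ?d"
        using lipschitz_onD[OF lip mem assms(2)] t
        by (intro mult_right_mono) (auto simp: dist_norm)
      finally show ?thesis by (simp add: inner_diff_left power2_eq_square algebra_simps)
    qed
    ultimately show "\<exists>D. (?\<phi> has_real_derivative D) (at t) \<and> 0 \<le> D" by blast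
  qed simp
  then show ?thesis by simp
qed

section \<open>Cocoercivity and nonexpansive gradient steps\<close>

text \<open>The part of the gradient increment normal to the affine hull of \<open>S\<close> is not controlled, so
  only its tangential part \<open>a\<close> (up to sign) appears.\<close>

lemma concave_gradient_cocoercive:
  fixes f :: "'a::real_inner \<Rightarrow> real"
  assumes "convex S" and x: "x \<in> S" and y: "y \<in> S"
    and conc: "concave_on UNIV f"
    and grad: "\<And>u. u \<in> S \<Longrightarrow> GDERIV f u :> g u"
    and lip: "K-lipschitz_on S g" and K: "K > 0"
    and tang: "(g y - g x) \<bullet> a = (norm a)\<^sup>2"
    and steps: "x - (1 / K) *\<^sub>R a \<in> S" "y + (1 / K) *\<^sub>R a \<in> S"
  shows "(norm a)\<^sup>2 \<le> K * ((g y - g x) \<bullet> (x - y))"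
proof -
  have sq: "K / 2 * (norm ((1 / K) *\<^sub>R a))\<^sup>2 = (norm a)\<^sup>2 / (2 * K)"
    using K by (simp add: power2_eq_square)
  \<comment> \<open>Each trial point is bounded above by the tangent at the other base point and
    below by the quadratic bound at its own. In the sum of the four inequalities all values of
    \<open>f\<close> cancel.\<close>
  have "f y + g y \<bullet> (x - (1 / K) *\<^sub>R a - y) \<ge> f (x - (1 / K) *\<^sub>R a)"
    by (rule concave_on_UNIV_gradient_ge[OF conc grad[OF y]])
  moreover have "f (x - (1 / K) *\<^sub>R a) \<ge> f x - g x \<bullet> ((1 / K) *\<^sub>R a) - (norm a)\<^sup>2 / (2 * K)"
    using lipschitz_gradient_lower_bound[OF assms(1) x steps(1) grad lip] sq by simp
  moreover have "f x + g x \<bullet> (y + (1 / K) *\<^sub>R a - x) \<ge> f (y + (1 / K) *\<^sub>R a)"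
    by (rule concave_on_UNIV_gradient_ge[OF conc grad[OF x]])
  moreover have "f (y + (1 / K) *\<^sub>R a) \<ge> f y + g y \<bullet> ((1 / K) *\<^sub>R a) - (norm a)\<^sup>2 / (2 * K)"
    using lipschitz_gradient_lower_bound[OF assms(1) y steps(2) grad lip] sq by simp
  moreover have "(1 / K) * (g y \<bullet> a) - (1 / K) * (g x \<bullet> a) = (norm a)\<^sup>2 / K"
    using tang K by (simp add: inner_diff_left field_simps)
  ultimately have "(norm a)\<^sup>2 / K \<le> (g y - g x) \<bullet> (x - y)"
    by (simp add: inner_diff_left inner_diff_right inner_add_right field_simps)
  then show ?thesis using K by (simp add: field_simps)
qed

text \<open>Testing against \<open>d \<in> V\<close> removes the component of the gradient increment
  normal to \<open>V\<close>. The tangential component \<open>a\<close> has norm at most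
  \<open>K * norm (x - y)\<close>, so the trial points of the cocoercivity inequality stay within
  the room around \<open>x\<close> and \<open>y\<close>. A linear test also adds up along a
  subdivision of a segment.\<close>

lemma gradient_step_nonexpansive_nearby:
  fixes f :: "'a::euclidean_space \<Rightarrow> real"
  assumes "convex S" and V: "subspace V" and x: "x \<in> S" and y: "y \<in> S"
    and xyV: "x - y \<in> V" and room: "\<And>v. v \<in> V \<Longrightarrow> norm v \<le> norm (x - y) \<Longrightarrow> x + v \<in> S \<and> y + v \<in> S"
    and conc: "concave_on UNIV f"
    and grad: "\<And>u. u \<in> S \<Longrightarrow> GDERIV f u :> g u"
    and lip: "K-lipschitz_on S g" and ab: "\<alpha> \<ge> 0" "\<beta> \<ge> 0" "\<beta> * K \<le> 2 * \<alpha>"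
    and d: "d \<in> V"
  shows "d \<bullet> (\<alpha> *\<^sub>R (x - y) + \<beta> *\<^sub>R (g x - g y)) \<le> \<alpha> * norm d * norm (x - y)"
proof (cases "K = 0")
  case True
  have "g x = g y" using lipschitz_onD[OF lip x y] True by simp
  then show ?thesis
    using ab norm_cauchy_schwarz[of d "\<alpha> *\<^sub>R (x - y)"] by (simp add: mult_ac)
next
  case False
  then have K: "K > 0" using lipschitz_on_nonneg[OF lip] by simp
  obtain a b where a: "a \<in> V" and b: "\<And>w. w \<in> V \<Longrightarrow> b \<bullet> w = 0" and w: "g y - g x = a + b"
    using orthogonal_subspace_decomp_exists[of V "g y - g x"] V
    by (metis orthogonal_def span_eq_iff)
  have tang: "(g y - g x) \<bullet> a = (norm a)\<^sup>2"
    using b[OF a] by (simp add: w inner_add_left power2_norm_eq_inner)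
  have "(norm a)\<^sup>2 \<le> norm (g y - g x) * norm a"
    using norm_cauchy_schwarz[of "g y - g x" a] tang by simp
  then have "norm a \<le> norm (g y - g x)"
    by (cases "norm a = 0") (auto simp: power2_eq_square)
  also have "\<dots> \<le> K * norm (x - y)"
    using lipschitz_onD[OF lip y x] by (simp add: dist_norm norm_minus_commute)
  finally have na: "norm ((1 / K) *\<^sub>R a) \<le> norm (x - y)"
    using K by (simp add: field_simps)
  have aV: "(1 / K) *\<^sub>R a \<in> V" "- ((1 / K) *\<^sub>R a) \<in> V"
    using a V by (auto intro: subspace_scale subspace_neg)
  have "(norm a)\<^sup>2 \<le> K * ((g y - g x) \<bullet> (x - y))"
    using room[OF aV(1)] room[OF aV(2)] na
    by (intro concave_gradient_cocoercive[OF assms(1) x y conc grad lip K tang]) auto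
  then have coc: "(norm a)\<^sup>2 \<le> K * (a \<bullet> (x - y))"
    using b[OF xyV] by (simp add: w inner_add_left)
  then have pos: "a \<bullet> (x - y) \<ge> 0" using K
    by (metis dual_order.trans mult_le_cancel_left_pos mult_zero_right zero_le_power2)
  \<comment> \<open>Cocoercivity times \<open>\<beta>\<^sup>2\<close>, combined with
    \<open>\<beta> * K \<le> 2 * \<alpha>\<close>: the square of the term with \<open>a\<close> is
    absorbed by the cross term when the norm below is expanded.\<close>
  have "\<beta>\<^sup>2 * (norm a)\<^sup>2 \<le> \<beta> * (\<beta> * K) * (a \<bullet> (x - y))"
    using mult_left_mono[OF coc, of "\<beta>\<^sup>2"] by (simp add: power2_eq_square mult_ac)
  also have "\<dots> \<le> \<beta> * (2 * \<alpha>) * (a \<bullet> (x - y))"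
    using ab pos by (intro mult_right_mono mult_left_mono) auto
  finally have "(norm (\<alpha> *\<^sub>R (x - y) - \<beta> *\<^sub>R a))\<^sup>2 \<le> (\<alpha> * norm (x - y))\<^sup>2"
    unfolding power2_norm_eq_inner power_mult_distrib
    by (simp add: inner_diff_left inner_diff_right inner_commute power2_eq_square algebra_simps)
  then have le: "norm (\<alpha> *\<^sub>R (x - y) - \<beta> *\<^sub>R a) \<le> \<alpha> * norm (x - y)"
    using ab by (meson mult_nonneg_nonneg norm_ge_zero power2_le_imp_le)
  have "g x - g y = - (a + b)" using w by (metis minus_diff_eq)
  then have "d \<bullet> (\<alpha> *\<^sub>R (x - y) + \<beta> *\<^sub>R (g x - g y)) = d \<bullet> (\<alpha> *\<^sub>R (x - y) - \<beta> *\<^sub>R a)"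
    using b[OF d] by (simp add: inner_diff_right inner_add_right inner_commute)
  also have "\<dots> \<le> norm d * norm (\<alpha> *\<^sub>R (x - y) - \<beta> *\<^sub>R a)" by (rule norm_cauchy_schwarz)
  also have "\<dots> \<le> norm d * (\<alpha> * norm (x - y))" by (rule mult_left_mono[OF le]) simp
  finally show ?thesis by (simp add: mult_ac)
qed

text \<open>Cocoercivity needs room in \<open>S\<close> comparable to the distance of the two points; subdividing the
  segment between them reduces this to an arbitrary amount \<open>e\<close> of room.\<close>

lemma gradient_step_nonexpansive_thick:
  fixes f :: "'a::euclidean_space \<Rightarrow> real"
  assumes "convex S" and V: "subspace V" and e: "e > 0"
    and xyV: "x - y \<in> V" and room: "\<And>v. v \<in> V \<Longrightarrow> norm v \<le> e \<Longrightarrow> x + v \<in> S \<and> y + v \<in> S"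
    and conc: "concave_on UNIV f"
    and grad: "\<And>u. u \<in> S \<Longrightarrow> GDERIV f u :> g u"
    and lip: "K-lipschitz_on S g" and ab: "\<alpha> \<ge> 0" "\<beta> \<ge> 0" "\<beta> * K \<le> 2 * \<alpha>"
    and d: "d \<in> V"
  shows "d \<bullet> (\<alpha> *\<^sub>R (x - y) + \<beta> *\<^sub>R (g x - g y)) \<le> \<alpha> * norm d * norm (x - y)"
proof -
  \<comment> \<open>Enough pieces that none is longer than the available room
    \<open>e\<close>.\<close>
  obtain N :: nat where N: "N > 0" "norm (x - y) / e < real N"
    using reals_Archimedean2[of "norm (x - y) / e"] e
    by (metis bot_nat_0.not_eq_extremum divide_nonneg_pos linorder_not_less norm_ge_zero of_nat_0)
  define p where "p i = y + (real i / real N) *\<^sub>R (x - y)" for i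
  have step: "p (Suc i) - p i = (1 / real N) *\<^sub>R (x - y)" for i
    using N by (simp add: p_def scaleR_left_diff_distrib[symmetric] diff_divide_distrib[symmetric])
  have small: "norm (x - y) / real N \<le> e"
    using N e by (simp add: field_simps)
  \<comment> \<open>Convexity passes the room at both ends on to every point between them.\<close>
  have room_p: "p i + v \<in> S" if "i \<le> N" "v \<in> V" "norm v \<le> e" for i v
  proof -
    have "(1 - real i / N) *\<^sub>R (y + v) + (real i / N) *\<^sub>R (x + v) \<in> S"
      using room[OF that(2,3)] N that(1) by (intro convexD[OF assms(1)]) auto
    then show ?thesis by (simp add: p_def algebra_simps)
  qed
  \<comment> \<open>The tested expression is a difference of values of \<open>?T\<close>, so the
    estimates on the pieces telescope while the lengths of the pieces add up to
    \<open>norm (x - y)\<close>.\<close>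
  let ?T = "\<lambda>z. d \<bullet> (\<alpha> *\<^sub>R z + \<beta> *\<^sub>R g z)"
  have "?T (p (Suc i)) - ?T (p i) \<le> \<alpha> * norm d * (norm (x - y) / N)" if "i < N" for i
  proof -
    have nstep: "norm (p (Suc i) - p i) = norm (x - y) / N" using step[of i] by simp
    have "d \<bullet> (\<alpha> *\<^sub>R (p (Suc i) - p i) + \<beta> *\<^sub>R (g (p (Suc i)) - g (p i)))
        \<le> \<alpha> * norm d * norm (p (Suc i) - p i)"
    proof (rule gradient_step_nonexpansive_nearby[OF assms(1) V _ _ _ _ conc grad lip ab d])
      show "p (Suc i) \<in> S" "p i \<in> S"
        using room_p[of "Suc i" 0] room_p[of i 0] that e V by (auto simp: subspace_0)
      show "p (Suc i) - p i \<in> V" using step xyV V by (simp add: subspace_scale)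
      show "p (Suc i) + v \<in> S \<and> p i + v \<in> S" if "v \<in> V" "norm v \<le> norm (p (Suc i) - p i)" for v
        using room_p[of "Suc i" v] room_p[of i v] that \<open>i < N\<close> small unfolding nstep by auto
    qed
    then show ?thesis
      unfolding nstep by (simp add: scaleR_diff_right inner_add_right inner_diff_right)
  qed
  then have "(\<Sum>i<N. ?T (p (Suc i)) - ?T (p i)) \<le> (\<Sum>i<N. \<alpha> * norm d * (norm (x - y) / N))"
    by (intro sum_mono) auto
  also have "\<dots> = \<alpha> * norm d * norm (x - y)" using N by simp
  finally have "?T (p N) - ?T (p 0) \<le> \<alpha> * norm d * norm (x - y)"
    using sum_lessThan_telescope[of "\<lambda>i. ?T (p i)" N] by simp
  moreover have "p N = x" "p 0 = y" using N by (auto simp: p_def)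
  ultimately show ?thesis by (simp add: algebra_simps inner_add_right inner_diff_right)
qed

text \<open>Points on the relative boundary of \<open>S\<close> have no room. Both points are
  therefore shrunk towards a relative interior point \<open>c\<close>, where the inequality is
  known, and the limit is taken by continuity of \<open>g\<close> on \<open>S\<close>.\<close>

lemma gradient_step_nonexpansive:
  fixes f :: "'a::euclidean_space \<Rightarrow> real"
  assumes S: "convex S" and x: "x \<in> S" and y: "y \<in> S"
    and conc: "concave_on UNIV f"
    and grad: "\<And>u. u \<in> S \<Longrightarrow> GDERIV f u :> g u"
    and lip: "K-lipschitz_on S g" and ab: "\<alpha> \<ge> 0" "\<beta> \<ge> 0" "\<beta> * K \<le> 2 * \<alpha>"
    and uv: "u \<in> S" "v \<in> S"
  shows "(u - v) \<bullet> (\<alpha> *\<^sub>R (x - y) + \<beta> *\<^sub>R (g x - g y)) \<le> \<alpha> * norm (u - v) * norm (x - y)"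
proof -
  obtain c e where c: "c \<in> S" and e: "e > 0" "cball c e \<inter> affine hull S \<subseteq> S"
    using rel_interior_eq_empty[OF S] x mem_rel_interior_cball by blast
  \<comment> \<open>The direction space of the affine hull of \<open>S\<close>; it contains all
    differences of points of \<open>S\<close>.\<close>
  define V where "V = span ((\<lambda>z. -c + z) ` (S - {c}))"
  have V: "subspace V" by (simp add: V_def)
  have cV: "z - c \<in> V" if "z \<in> S" for z
    using that span_base[of "z - c" "(\<lambda>z. -c + z) ` (S - {c})"]
    by (cases "z = c") (auto simp: V_def span_zero image_iff)
  have dV: "z - w \<in> V" if "z \<in> S" "w \<in> S" for z w
    using subspace_diff[OF V cV[OF that(1)] cV[OF that(2)]] by simp
  have ball: "c + v \<in> S" if "v \<in> V" "norm v \<le> e" for v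
  proof -
    have "c + v \<in> affine hull S"
      using affine_hull_span2[OF c] that(1) by (auto simp: V_def)
    then show ?thesis using e that(2) by (auto simp: dist_norm)
  qed
  define shr where "shr z n = z + (1 / real (Suc n)) *\<^sub>R (c - z)" for z n
  have shr_eq: "shr z n = (1 - 1 / real (Suc n)) *\<^sub>R z + (1 / real (Suc n)) *\<^sub>R c" for z n
    by (simp add: shr_def algebra_simps)
  have shr_in: "shr z n \<in> S" if "z \<in> S" for z n
    unfolding shr_eq using that c by (intro convexD[OF S]) auto
  \<comment> \<open>Shrinking by the fraction \<open>1 / real (Suc n)\<close> inherits that fraction
    of the room at \<open>c\<close>: the shift by \<open>w\<close> comes from shifting
    \<open>c\<close> by \<open>real (Suc n) *\<^sub>R w\<close>.\<close>
  have room: "shr z n + w \<in> S" if "z \<in> S" "w \<in> V" "norm w \<le> e / real (Suc n)" for z n w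
  proof -
    have "c + real (Suc n) *\<^sub>R w \<in> S"
      using that V by (intro ball) (auto simp: subspace_scale field_simps simp del: of_nat_Suc)
    then have "(1 - 1 / real (Suc n)) *\<^sub>R z + (1 / real (Suc n)) *\<^sub>R (c + real (Suc n) *\<^sub>R w) \<in> S"
      using that by (intro convexD[OF S]) auto
    then show ?thesis by (simp add: shr_eq scaleR_add_right add.assoc del: of_nat_Suc)
  qed
  have ineq: "(u - v) \<bullet> (\<alpha> *\<^sub>R (shr x n - shr y n) + \<beta> *\<^sub>R (g (shr x n) - g (shr y n)))
      \<le> \<alpha> * norm (u - v) * norm (shr x n - shr y n)" for n
    by (rule gradient_step_nonexpansive_thick[OF S V _ dV[OF shr_in[OF x] shr_in[OF y]] _ conc grad lip ab dV[OF uv],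
          of "e / real (Suc n)"]) (use e room x y in \<open>auto simp del: of_nat_Suc\<close>)
  have lim: "(\<lambda>n. shr z n) \<longlonglongrightarrow> z" for z
  proof -
    have "(\<lambda>n. z + (1 / real (Suc n)) *\<^sub>R (c - z)) \<longlonglongrightarrow> z + 0 *\<^sub>R (c - z)"
      by (intro tendsto_intros LIMSEQ_Suc lim_1_over_n)
    then show ?thesis by (simp add: shr_def)
  qed
  have limg: "(\<lambda>n. g (shr z n)) \<longlonglongrightarrow> g z" if "z \<in> S" for z
    using continuous_on_tendsto_compose[OF lipschitz_on_continuous_on[OF lip] lim that] shr_in[OF that]
    by auto
  show ?thesis
  proof (rule LIMSEQ_le)
    show "(\<lambda>n. (u - v) \<bullet> (\<alpha> *\<^sub>R (shr x n - shr y n) + \<beta> *\<^sub>R (g (shr x n) - g (shr y n))))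
        \<longlonglongrightarrow> (u - v) \<bullet> (\<alpha> *\<^sub>R (x - y) + \<beta> *\<^sub>R (g x - g y))"
      by (intro tendsto_intros lim limg x y)
    show "(\<lambda>n. \<alpha> * norm (u - v) * norm (shr x n - shr y n)) \<longlonglongrightarrow> \<alpha> * norm (u - v) * norm (x - y)"
      by (intro tendsto_intros lim)
  qed (use ineq in blast)
qed

section \<open>Projections and contraction of the regularized step\<close>

lemma closest_point_firmly_nonexpansive:
  fixes S :: "'a::euclidean_space set"
  assumes "convex S" "closed S" "S \<noteq> {}"
  shows "(norm (closest_point S a - closest_point S b))\<^sup>2
    \<le> (closest_point S a - closest_point S b) \<bullet> (a - b)"
proof -
  let ?p = "closest_point S a" and ?q = "closest_point S b"
  have "(a - ?p) \<bullet> (?q - ?p) \<le> 0" "(b - ?q) \<bullet> (?p - ?q) \<le> 0"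
    using assms by (auto intro!: closest_point_dot closest_point_in_set)
  then show ?thesis
    unfolding power2_norm_eq_inner by (simp add: algebra_simps inner_commute inner_diff_left inner_diff_right)
qed

text \<open>Firm nonexpansiveness asks for \<open>a - b\<close> only as tested against the
  difference of the projections, which is parallel to the affine hull of \<open>S\<close>. This is
  the form in which the gradient step is controlled.\<close>

lemma closest_point_dist_le:
  fixes S :: "'a::euclidean_space set"
  assumes "convex S" "closed S" "S \<noteq> {}"
    and "(closest_point S a - closest_point S b) \<bullet> (a - b) \<le> r * norm (closest_point S a - closest_point S b)"
    and "r \<ge> 0"
  shows "norm (closest_point S a - closest_point S b) \<le> r"
proof (cases "closest_point S a = closest_point S b")
  case False
  have "norm (closest_point S a - closest_point S b) * norm (closest_point S a - closest_point S b)
      \<le> r * norm (closest_point S a - closest_point S b)"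
    using closest_point_firmly_nonexpansive[OF assms(1-3), of a b] assms(4)
    by (simp add: power2_eq_square)
  then show ?thesis using False by (simp add: mult_le_cancel_right)
qed (use assms(5) in simp)

text \<open>The arguments of the two projections differ by
  \<open>\<alpha> *\<^sub>R (x - y) + \<beta> *\<^sub>R (g x - g y)\<close> with
  \<open>\<alpha> = 1 - s * \<mu>\<close> and \<open>\<beta> = s\<close>; the step-size bound is
  exactly \<open>\<beta> * K \<le> 2 * \<alpha>\<close>.\<close>

lemma regularized_gradient_step_contraction:
  fixes f :: "'a::euclidean_space \<Rightarrow> real"
  assumes S: "convex S" "closed S" and x: "x \<in> S" and y: "y \<in> S"
    and conc: "concave_on UNIV f"
    and grad: "\<And>u. u \<in> S \<Longrightarrow> GDERIV f u :> g u"
    and lip: "K-lipschitz_on S g"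
    and s: "s \<ge> 0" "s * (K + 2 * \<mu>) \<le> 2"
  shows "norm (closest_point S (x + s *\<^sub>R (g x - \<mu> *\<^sub>R (x - c)))
      - closest_point S (y + s *\<^sub>R (g y - \<mu> *\<^sub>R (y - c)))) \<le> (1 - s * \<mu>) * norm (x - y)"
proof (rule closest_point_dist_le)
  show "S \<noteq> {}" using x by auto
  have K: "K \<ge> 0" by (rule lipschitz_on_nonneg[OF lip])
  have nn: "1 - s * \<mu> \<ge> 0" using s mult_nonneg_nonneg[OF s(1) K] by (simp add: algebra_simps)
  then show "0 \<le> (1 - s * \<mu>) * norm (x - y)" by simp
  let ?a = "x + s *\<^sub>R (g x - \<mu> *\<^sub>R (x - c))" and ?b = "y + s *\<^sub>R (g y - \<mu> *\<^sub>R (y - c))"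
  have "?a - ?b = (1 - s * \<mu>) *\<^sub>R (x - y) + s *\<^sub>R (g x - g y)"
    by (simp add: algebra_simps)
  moreover have "closest_point S ?a \<in> S" "closest_point S ?b \<in> S"
    using S x by (auto intro!: closest_point_in_set)
  moreover have "s * K \<le> 2 * (1 - s * \<mu>)" using s by (simp add: algebra_simps)
  ultimately show "(closest_point S ?a - closest_point S ?b) \<bullet> (?a - ?b)
      \<le> (1 - s * \<mu>) * norm (x - y) * norm (closest_point S ?a - closest_point S ?b)"
    using gradient_step_nonexpansive[OF S(1) x y conc grad lip nn s(1), of "closest_point S ?a" "closest_point S ?b"]
    by (simp only: mult_ac)
qed (use S in auto)

subsection \<open>Convergence of CG-RPGA\<close>

locale saddle_problem =
  fixes X :: "'a::real_normed_vector set" and Y :: "'b::euclidean_space set"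
    and L :: "'a \<Rightarrow> 'b \<Rightarrow> real"
    and gx :: "'a \<Rightarrow> 'b \<Rightarrow> 'a \<Rightarrow>\<^sub>L real" and gy :: "'a \<Rightarrow> 'b \<Rightarrow> 'b"
    and Lxx Lyx Lyy :: real
  assumes X: "convex X" "bounded X" and Y: "convex Y" "compact Y"
    and L_consts: "Lxx \<ge> 0" "Lyx \<ge> 0" "Lyy \<ge> 0"
    and gx_deriv: "\<And>x y. y \<in> Y \<Longrightarrow> ((\<lambda>x. L x y) has_derivative blinfun_apply (gx x y)) (at x)"
    and gx_Lipschitz: "\<And>x x' y y'. x \<in> X \<Longrightarrow> x' \<in> X \<Longrightarrow> y \<in> Y \<Longrightarrow> y' \<in> Y \<Longrightarrow>
          norm (gx x y - gx x' y') \<le> Lxx * norm (x - x') + Lyx * norm (y - y')"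
    and concave: "\<And>x. x \<in> X \<Longrightarrow> concave_on UNIV (L x)"
    and gy_deriv: "\<And>x y. x \<in> X \<Longrightarrow> GDERIV (L x) y :> gy x y"
    and gy_Lipschitz: "\<And>x x' y y'. x \<in> X \<Longrightarrow> x' \<in> X \<Longrightarrow> y \<in> Y \<Longrightarrow> y' \<in> Y \<Longrightarrow>
          norm (gy x y - gy x' y') \<le> Lyx * norm (x - x') + Lyy * norm (y - y')"
begin

abbreviation "DX \<equiv> diameter X"
abbreviation "DY \<equiv> diameter Y"

lemma DX_nonneg: "DX \<ge> 0" and DY_nonneg: "DY \<ge> 0"
  using X(2) Y(2) compact_imp_bounded diameter_ge_0 by auto

lemma norm_diff_le_DX: "x \<in> X \<Longrightarrow> x' \<in> X \<Longrightarrow> norm (x - x') \<le> DX"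
  using diameter_bounded_bound[OF X(2)] by (simp add: dist_norm)

lemma norm_diff_le_DY: "y \<in> Y \<Longrightarrow> y' \<in> Y \<Longrightarrow> norm (y - y') \<le> DY"
  using diameter_bounded_bound[OF compact_imp_bounded[OF Y(2)]] by (simp add: dist_norm)

lemma gy_lipschitz_on: "x \<in> X \<Longrightarrow> Lyy-lipschitz_on Y (gy x)"
  using gy_Lipschitz[of x x] L_consts(3) by (intro lipschitz_onI) (auto simp: dist_norm)

text \<open>The Lipschitz bound from one base point and the finite diameters give an
  \<open>M\<close> independent of the parameters of the algorithm; it will bound the oscillation of
  the value function.\<close>

lemma gx_bounded: "\<exists>M\<ge>0. \<forall>x\<in>X. \<forall>y\<in>Y. norm (gx x y) \<le> M"
proof (cases "X = {} \<or> Y = {}")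
  case False
  then obtain x0 y0 where 0: "x0 \<in> X" "y0 \<in> Y" by auto
  have "norm (gx x y) \<le> norm (gx x0 y0) + (Lxx * DX + Lyx * DY)" if "x \<in> X" "y \<in> Y" for x y
  proof -
    have "norm (gx x y) \<le> norm (gx x0 y0) + norm (gx x y - gx x0 y0)"
      by (metis add.commute diff_add_cancel norm_triangle_ineq)
    moreover have "norm (gx x y - gx x0 y0) \<le> Lxx * norm (x - x0) + Lyx * norm (y - y0)"
      using gx_Lipschitz that 0 by auto
    moreover have "Lxx * norm (x - x0) \<le> Lxx * DX" "Lyx * norm (y - y0) \<le> Lyx * DY"
      using norm_diff_le_DX norm_diff_le_DY that 0 L_consts by (auto intro: mult_left_mono)
    ultimately show ?thesis by linarith
  qed
  moreover have "0 \<le> norm (gx x0 y0) + (Lxx * DX + Lyx * DY)"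
    using DX_nonneg DY_nonneg L_consts by simp
  ultimately show ?thesis by blast
qed auto

text \<open>A real \<open>SUP\<close> dominates its members only when they are bounded above; here
  the dual norm times the diameter is a bound.\<close>

lemma gap_X_upper: assumes "x \<in> X" "x' \<in> X" shows "gx x y (x - x') \<le> gap_X X gx x y"
  unfolding gap_X_def
proof (rule cSUP_upper[OF assms(2)])
  have "gx x y (x - z) \<le> norm (gx x y) * DX" if "z \<in> X" for z
    using norm_blinfun[of "gx x y" "x - z"]
      mult_left_mono[OF norm_diff_le_DX[OF assms(1) that] norm_ge_zero[of "gx x y"]] by simp
  then show "bdd_above ((\<lambda>z. gx x y (x - z)) ` X)" by (auto intro!: bdd_aboveI)
qed

text \<open>The mean value theorem gives the gradient at an intermediate point, which is then
  compared with the one at \<open>x\<close>. This yields \<open>Lxx\<close> instead of the sharper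
  \<open>Lxx / 2\<close>, with no effect on the rate.\<close>

lemma L_increment_x_le:
  assumes "x \<in> X" "x' \<in> X" "y \<in> Y"
  shows "L x' y - L x y \<le> gx x y (x' - x) + Lxx * (norm (x' - x))\<^sup>2"
proof -
  obtain u where u: "u \<in> closed_segment x x'" and eq: "L x' y - L x y = gx u y (x' - x)"
    using has_derivative_segment_mvt[of x x' "\<lambda>x. L x y" "\<lambda>x. gx x y"] gx_deriv assms by auto
  have uX: "u \<in> X" using u closed_segment_subset[OF assms(1,2) X(1)] by auto
  have "gx u y (x' - x) - gx x y (x' - x) = (gx u y - gx x y) (x' - x)"
    by (simp add: blinfun.diff_left)
  also have "\<dots> \<le> norm (gx u y - gx x y) * norm (x' - x)"
    using norm_blinfun[of "gx u y - gx x y" "x' - x"] by simp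
  also have "\<dots> \<le> (Lxx * norm (x' - x)) * norm (x' - x)"
  proof (rule mult_right_mono)
    have "norm (u - x) \<le> norm (x' - x)"
      using segment_bound1[OF u] by (simp add: norm_minus_commute)
    then show "norm (gx u y - gx x y) \<le> Lxx * norm (x' - x)"
      using gx_Lipschitz[OF uX assms(1,3,3)] mult_left_mono[of _ _ Lxx] L_consts(1) by fastforce
  qed simp
  finally show ?thesis using eq by (simp add: power2_eq_square)
qed

end

text \<open>The step-size bound is kept free of division, and \<open>\<tau> \<le> 1\<close> makes
  each primal step a convex combination of points of \<open>X\<close>.\<close>

locale cg_rpga_run = saddle_problem X Y L gx gy Lxx Lyx Lyy
  for X :: "'a::real_normed_vector set" and Y :: "'b::euclidean_space set"
    and L gx gy Lxx Lyx Lyy +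
  fixes \<mu> \<tau> \<sigma> :: real and xs :: "nat \<Rightarrow> 'a" and ys :: "nat \<Rightarrow> 'b"
  assumes params: "\<mu> > 0" "\<tau> > 0" "\<tau> \<le> 1" "\<sigma> > 0" "\<sigma> * (Lyy + 2 * \<mu>) \<le> 2"
    and run: "cg_rpga X Y gx gy \<mu> (\<lambda>_. \<tau>) (\<lambda>_. \<sigma>) xs ys"
begin

section \<open>Iterates of a run\<close>

definition dual_step :: "'a \<Rightarrow> 'b \<Rightarrow> 'b"
  where "dual_step x y = closest_point Y (y + \<sigma> *\<^sub>R (gy x y - \<mu> *\<^sub>R (y - ys 0)))"

lemma xs_step: "\<exists>s\<in>X. xs (Suc k) = \<tau> *\<^sub>R s + (1 - \<tau>) *\<^sub>R xs k
    \<and> (\<forall>x\<in>X. gx (xs k) (ys k) s \<le> gx (xs k) (ys k) x)"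
  using run unfolding cg_rpga_def is_arg_min_linorder by metis

lemma ys_step: "ys (Suc k) = dual_step (xs k) (ys k)"
  using run unfolding cg_rpga_def dual_step_def by metis

lemma Y_closed: "closed Y" and Y_nonempty: "Y \<noteq> {}"
  using Y run compact_imp_closed by (auto simp: cg_rpga_def)

lemma dual_step_in: "dual_step x y \<in> Y"
  unfolding dual_step_def using Y_closed Y_nonempty by (rule closest_point_in_set)

lemma ys_in: "ys k \<in> Y"
  using run dual_step_in by (cases k) (auto simp: ys_step cg_rpga_def)

lemma xs_in: "xs k \<in> X"
proof (induction k)
  case 0 then show ?case using run by (simp add: cg_rpga_def)
next
  case (Suc k)
  obtain s where s: "s \<in> X" "xs (Suc k) = \<tau> *\<^sub>R s + (1 - \<tau>) *\<^sub>R xs k" using xs_step by blast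
  show ?case unfolding s(2) using params by (intro convexD[OF X(1) s(1) Suc]) auto
qed

lemma norm_xs_step_le: "norm (xs (Suc k) - xs k) \<le> \<tau> * DX"
proof -
  obtain s where s: "s \<in> X" "xs (Suc k) = \<tau> *\<^sub>R s + (1 - \<tau>) *\<^sub>R xs k" using xs_step by blast
  have "xs (Suc k) - xs k = \<tau> *\<^sub>R (s - xs k)" using s(2) by (simp add: algebra_simps)
  then show ?thesis using norm_diff_le_DX[OF s(1) xs_in] params by simp
qed

text \<open>The oracle point attains the supremum that defines the gap, and the iterate moves the
  fraction \<open>\<tau>\<close> of the way towards it.\<close>

lemma gx_xs_step_le: "gx (xs k) (ys k) (xs (Suc k) - xs k) \<le> - \<tau> * gap_X X gx (xs k) (ys k)"
proof -
  obtain s where s: "s \<in> X" "xs (Suc k) = \<tau> *\<^sub>R s + (1 - \<tau>) *\<^sub>R xs k"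
    "\<And>x. x \<in> X \<Longrightarrow> gx (xs k) (ys k) s \<le> gx (xs k) (ys k) x" using xs_step by blast
  have "gap_X X gx (xs k) (ys k) \<le> gx (xs k) (ys k) (xs k - s)"
    unfolding gap_X_def using s xs_in by (intro cSUP_least) (auto simp: blinfun.diff_right)
  moreover have "xs (Suc k) - xs k = (- \<tau>) *\<^sub>R (xs k - s)"
    using s(2) by (simp add: algebra_simps)
  ultimately show ?thesis
    using params by (simp add: blinfun.scaleR_right blinfun.minus_right)
qed

lemma sigma_mu: "0 < \<sigma> * \<mu>" "\<sigma> * \<mu> \<le> 1"
proof -
  have "\<sigma> * Lyy \<ge> 0" using params L_consts by simp
  then show "\<sigma> * \<mu> \<le> 1" using params(5) by (simp add: distrib_left)
qed (use params in simp)

section \<open>Contraction of the dual step and its fixed point\<close>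

lemma dual_step_contraction:
  assumes "x \<in> X" "y \<in> Y" "z \<in> Y"
  shows "norm (dual_step x y - dual_step x z) \<le> (1 - \<sigma> * \<mu>) * norm (y - z)"
  unfolding dual_step_def using params
  by (intro regularized_gradient_step_contraction[OF Y(1) Y_closed assms(2,3)
        concave[OF assms(1)] gy_deriv[OF assms(1)] gy_lipschitz_on[OF assms(1)]]) auto

lemma dual_step_perturb:
  assumes "x \<in> X" "x' \<in> X" "y \<in> Y"
  shows "norm (dual_step x y - dual_step x' y) \<le> \<sigma> * Lyx * norm (x - x')"
proof -
  have "norm (dual_step x y - dual_step x' y) \<le> norm (\<sigma> *\<^sub>R (gy x y - gy x' y))"
    using closest_point_lipschitz[OF Y(1) Y_closed Y_nonempty,
        of "y + \<sigma> *\<^sub>R (gy x y - \<mu> *\<^sub>R (y - ys 0))" "y + \<sigma> *\<^sub>R (gy x' y - \<mu> *\<^sub>R (y - ys 0))"]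
    by (simp add: dual_step_def dist_norm algebra_simps)
  also have "\<dots> \<le> \<sigma> * (Lyx * norm (x - x'))"
    using gy_Lipschitz[OF assms(1,2,3,3)] params by simp
  finally show ?thesis by simp
qed

text \<open>Encoded as a fixed point so that the contraction estimates apply at once;
  \<open>ystar_maximizes\<close> identifies it as a maximizer of \<open>reg x\<close> over
  \<open>Y\<close>.\<close>

definition ystar :: "'a \<Rightarrow> 'b"
  where "ystar x = (SOME y. y \<in> Y \<and> dual_step x y = y)"

lemma ystar: assumes "x \<in> X" shows "ystar x \<in> Y" "dual_step x (ystar x) = ystar x"
proof -
  have "\<exists>!y\<in>Y. dual_step x y = y"
    by (rule Banach_fix[OF compact_imp_complete[OF Y(2)] Y_nonempty, of "1 - \<sigma> * \<mu>"])
      (use sigma_mu dual_step_in dual_step_contraction[OF assms] in \<open>auto simp: dist_norm\<close>)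
  then have "\<exists>y. y \<in> Y \<and> dual_step x y = y" by blast
  from someI_ex[OF this] show "ystar x \<in> Y" "dual_step x (ystar x) = ystar x"
    by (auto simp: ystar_def)
qed

text \<open>Through the intermediate point \<open>dual_step x (ystar x')\<close> the contraction
  absorbs all but the fraction \<open>\<sigma> * \<mu>\<close> of the distance, and
  \<open>\<sigma>\<close> cancels against the perturbation bound.\<close>

lemma ystar_lipschitz:
  assumes "x \<in> X" "x' \<in> X"
  shows "norm (ystar x - ystar x') \<le> Lyx / \<mu> * norm (x - x')"
proof -
  note y = ystar[OF assms(1)] and y' = ystar[OF assms(2)]
  have "ystar x - ystar x' = (dual_step x (ystar x) - dual_step x (ystar x'))
      + (dual_step x (ystar x') - dual_step x' (ystar x'))"
    using y(2) y'(2) by simp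
  then have "norm (ystar x - ystar x') \<le> (1 - \<sigma> * \<mu>) * norm (ystar x - ystar x')
      + \<sigma> * Lyx * norm (x - x')"
    using norm_triangle_le[OF add_mono[OF dual_step_contraction[OF assms(1) y(1) y'(1)]
          dual_step_perturb[OF assms y'(1)]]] by metis
  then have "\<sigma> * (\<mu> * norm (ystar x - ystar x')) \<le> \<sigma> * (Lyx * norm (x - x'))"
    by (simp add: algebra_simps)
  then show ?thesis using params by (simp add: field_simps)
qed

section \<open>The regularized value function\<close>

definition reg :: "'a \<Rightarrow> 'b \<Rightarrow> real"
  where "reg x y = L x y - \<mu> / 2 * (norm (y - ys 0))\<^sup>2"

text \<open>The fixed point equation is a variational inequality for the gradient of
  \<open>reg x\<close>; the tangent bounds for \<open>L x\<close> and for the squared norm turn it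
  into global maximality.\<close>

lemma ystar_maximizes:
  assumes "x \<in> X" "y \<in> Y"
  shows "reg x y \<le> reg x (ystar x)"
proof -
  let ?z = "ystar x"
  have "(?z + \<sigma> *\<^sub>R (gy x ?z - \<mu> *\<^sub>R (?z - ys 0)) - dual_step x ?z) \<bullet> (y - dual_step x ?z) \<le> 0"
    unfolding dual_step_def by (rule closest_point_dot[OF Y(1) Y_closed assms(2)])
  then have "\<sigma> * ((gy x ?z - \<mu> *\<^sub>R (?z - ys 0)) \<bullet> (y - ?z)) \<le> 0"
    by (simp add: ystar[OF assms(1)])
  then have vi: "(gy x ?z - \<mu> *\<^sub>R (?z - ys 0)) \<bullet> (y - ?z) \<le> 0"
    using params by (simp add: mult_le_0_iff)
  have "L x y \<le> L x ?z + gy x ?z \<bullet> (y - ?z)"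
    by (rule concave_on_UNIV_gradient_ge[OF concave gy_deriv]) fact+
  moreover have "(norm (y - ys 0))\<^sup>2 \<ge> (norm (?z - ys 0))\<^sup>2 + 2 * ((?z - ys 0) \<bullet> (y - ?z))"
  proof -
    have "(norm (y - ys 0))\<^sup>2 = (norm (?z - ys 0 + (y - ?z)))\<^sup>2" by simp
    also have "\<dots> = (norm (?z - ys 0))\<^sup>2 + 2 * ((?z - ys 0) \<bullet> (y - ?z)) + (norm (y - ?z))\<^sup>2"
      by (simp only: power2_norm_eq_inner inner_add_left inner_add_right inner_commute)
    finally show ?thesis by simp
  qed
  then have "\<mu> / 2 * (norm (y - ys 0))\<^sup>2 \<ge> \<mu> / 2 * ((norm (?z - ys 0))\<^sup>2 + 2 * ((?z - ys 0) \<bullet> (y - ?z)))"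
    using params by (intro mult_left_mono) auto
  ultimately show ?thesis using vi
    by (simp add: reg_def inner_diff_left algebra_simps)
qed

definition val :: "'a \<Rightarrow> real" where "val x = reg x (ystar x)"

text \<open>At \<open>x\<close> the point \<open>ystar x'\<close> is feasible but perhaps not
  optimal, and the regularization terms at this common dual point cancel.\<close>

lemma val_diff_le: assumes "x \<in> X" "x' \<in> X" shows "val x' - val x \<le> L x' (ystar x') - L x (ystar x')"
  using ystar_maximizes[OF assms(1) ystar(1)[OF assms(2)]] by (simp add: val_def reg_def)

lemma val_diff_bound:
  assumes "x \<in> X" "x' \<in> X" and M: "\<And>x y. x \<in> X \<Longrightarrow> y \<in> Y \<Longrightarrow> norm (gx x y) \<le> M"
  shows "val x' - val x \<le> M * DX"
proof -
  let ?y = "ystar x'"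
  have y: "?y \<in> Y" using ystar assms by auto
  obtain u where u: "u \<in> closed_segment x x'" and eq: "L x' ?y - L x ?y = gx u ?y (x' - x)"
    using has_derivative_segment_mvt[of x x' "\<lambda>x. L x ?y" "\<lambda>x. gx x ?y"] gx_deriv y by auto
  have uX: "u \<in> X" using u closed_segment_subset[OF assms(1,2) X(1)] by auto
  have "gx u ?y (x' - x) \<le> norm (gx u ?y) * norm (x' - x)"
    using norm_blinfun[of "gx u ?y" "x' - x"] by simp
  also have "\<dots> \<le> M * DX"
    by (rule mult_mono) (use M[OF uX y] norm_diff_le_DX assms norm_ge_zero order_trans in blast)+
  finally show ?thesis using val_diff_le[OF assms(1,2)] eq by simp
qed

section \<open>Tracking error of the dual iterates\<close>

definition err :: "nat \<Rightarrow> real" where "err k = norm (ys k - ystar (xs k))"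

lemma err_nonneg: "err k \<ge> 0" by (simp add: err_def)

text \<open>One dual step contracts towards the old maximizer, and the maximizer then drifts by at
  most \<open>Lyx / \<mu>\<close> times the length of the primal step.\<close>

lemma err_Suc: "err (Suc k) \<le> (1 - \<sigma> * \<mu>) * err k + Lyx * DX * \<tau> / \<mu>"
proof -
  have "err (Suc k) = norm ((dual_step (xs k) (ys k) - dual_step (xs k) (ystar (xs k)))
      + (ystar (xs k) - ystar (xs (Suc k))))"
    using ystar[OF xs_in] by (simp add: err_def ys_step)
  also have "\<dots> \<le> (1 - \<sigma> * \<mu>) * err k + Lyx / \<mu> * norm (xs k - xs (Suc k))"
    unfolding err_def
    by (intro norm_triangle_le add_mono dual_step_contraction ystar_lipschitz xs_in ys_in ystar)
  also have "Lyx / \<mu> * norm (xs k - xs (Suc k)) \<le> Lyx / \<mu> * (\<tau> * DX)"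
    using norm_xs_step_le[of k] params L_consts
    by (intro mult_left_mono) (auto simp: norm_minus_commute)
  finally show ?thesis by (simp add: mult_ac)
qed

text \<open>The second summand is the fixed point of the affine recursion in \<open>err_Suc\<close>:
  the drift divided by \<open>\<sigma> * \<mu>\<close>.\<close>

lemma err_le_power: "err k \<le> (1 - \<sigma> * \<mu>) ^ k * DY + Lyx * DX * \<tau> / (\<sigma> * \<mu>\<^sup>2)"
proof (induction k)
  case 0
  have "err 0 \<le> DY" unfolding err_def by (intro norm_diff_le_DY ys_in ystar xs_in)
  moreover have "0 \<le> Lyx * DX * \<tau> / (\<sigma> * \<mu>\<^sup>2)" using params L_consts DX_nonneg by simp
  ultimately show ?case by simp
next
  case (Suc k)
  have "(1 - \<sigma> * \<mu>) * err k
      \<le> (1 - \<sigma> * \<mu>) * ((1 - \<sigma> * \<mu>) ^ k * DY + Lyx * DX * \<tau> / (\<sigma> * \<mu>\<^sup>2))"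
    using Suc sigma_mu by (intro mult_left_mono) auto
  moreover have "(1 - \<sigma> * \<mu>) * (Lyx * DX * \<tau> / (\<sigma> * \<mu>\<^sup>2)) + Lyx * DX * \<tau> / \<mu>
      = Lyx * DX * \<tau> / (\<sigma> * \<mu>\<^sup>2)"
    using params by (simp add: field_simps power2_eq_square)
  ultimately show ?case using err_Suc[of k] by (simp add: algebra_simps)
qed

text \<open>With \<open>a = \<sigma> * \<mu>\<close>, Bernoulli gives
  \<open>a * k \<le> (1 + a) ^ k\<close>, and the product of \<open>(1 - a) ^ k\<close> and
  \<open>(1 + a) ^ k\<close> is at most 1.\<close>

lemma err_le:
  assumes "k > 0"
  shows "err k \<le> DY / (\<sigma> * \<mu> * k) + Lyx * DX * \<tau> / (\<sigma> * \<mu>\<^sup>2)"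
proof -
  let ?a = "\<sigma> * \<mu>"
  have "(1 - ?a) ^ k * (?a * k) \<le> (1 - ?a) ^ k * (1 + ?a) ^ k"
    using Bernoulli_inequality[of ?a k] sigma_mu by (intro mult_left_mono) (auto simp: mult_ac)
  also have "\<dots> = (1 - ?a\<^sup>2) ^ k"
    by (simp add: power_mult_distrib[symmetric] power2_eq_square algebra_simps)
  also have "\<dots> \<le> 1" using sigma_mu by (intro power_le_one) (auto simp: power_le_one)
  finally have "(1 - ?a) ^ k \<le> 1 / (?a * k)" using sigma_mu assms by (simp add: pos_le_divide_eq)
  then have "(1 - ?a) ^ k * DY \<le> 1 / (?a * k) * DY" using DY_nonneg by (rule mult_right_mono)
  then show ?thesis using err_le_power[of k] by simp
qed

lemma norm_ys_step_le: "norm (ys k - ys (Suc k)) \<le> 2 * err k"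
proof -
  have "ys k - ys (Suc k) = (ys k - ystar (xs k))
      - (dual_step (xs k) (ys k) - dual_step (xs k) (ystar (xs k)))"
    using ystar[OF xs_in] by (simp add: ys_step)
  then have "norm (ys k - ys (Suc k)) \<le> norm (ys k - ystar (xs k))
      + norm (dual_step (xs k) (ys k) - dual_step (xs k) (ystar (xs k)))"
    by (metis norm_triangle_ineq4)
  also have "\<dots> \<le> err k + (1 - \<sigma> * \<mu>) * err k"
    unfolding err_def by (intro add_mono order_refl dual_step_contraction xs_in ys_in ystar)
  also have "\<dots> \<le> 2 * err k" using mult_nonneg_nonneg[OF less_imp_le[OF sigma_mu(1)] err_nonneg[of k]]
    by (simp add: left_diff_distrib)
  finally show ?thesis .
qed

text \<open>The gap measures an unregularized projection step. Its end point differs from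
  \<open>ys (Suc k)\<close> by at most the size of the regularization term, as projections are
  nonexpansive.\<close>

lemma gap_Y_le: "gap_Y Y gy \<sigma> (xs k) (ys k) \<le> 2 / \<sigma> * err k + \<mu> * DY"
proof -
  let ?p = "closest_point Y (ys k + \<sigma> *\<^sub>R gy (xs k) (ys k))"
  have "norm (ys (Suc k) - ?p) \<le> norm (- (\<sigma> * \<mu>) *\<^sub>R (ys k - ys 0))"
    using closest_point_lipschitz[OF Y(1) Y_closed Y_nonempty,
        of "ys k + \<sigma> *\<^sub>R (gy (xs k) (ys k) - \<mu> *\<^sub>R (ys k - ys 0))" "ys k + \<sigma> *\<^sub>R gy (xs k) (ys k)"]
    by (simp add: ys_step dual_step_def dist_norm algebra_simps)
  also have "\<dots> \<le> \<sigma> * \<mu> * DY"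
    using mult_left_mono[OF norm_diff_le_DY[OF ys_in ys_in], of "\<sigma> * \<mu>"] sigma_mu by simp
  finally have "norm (ys k - ?p) \<le> 2 * err k + \<sigma> * \<mu> * DY"
    using norm_triangle_ineq[of "ys k - ys (Suc k)" "ys (Suc k) - ?p"] norm_ys_step_le[of k] by simp
  then show ?thesis using params by (simp add: gap_Y_def field_simps)
qed

section \<open>Descent of the value function and stationarity residuals\<close>

lemma val_descent:
  assumes "err k \<le> E"
  shows "val (xs (Suc k)) - val (xs k) \<le> - \<tau> * gap_X X gx (xs k) (ys k)
    + \<tau> * (DX * Lyx * (E + Lyx * DX * \<tau> / \<mu>) + Lxx * DX\<^sup>2 * \<tau>)"
proof -
  let ?x = "xs k" and ?x' = "xs (Suc k)"
  \<comment> \<open>\<open>val_diff_le\<close> compares the values at this dual point, whereas the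
    oracle used the gradient at \<open>ys k\<close>. The two dual points differ by at most the
    tracking error plus the drift of the maximizer, which bounds the loss.\<close>
  let ?y = "ystar ?x'"
  have y: "?y \<in> Y" by (intro ystar xs_in)
  have "norm (?y - ys k) \<le> norm (ystar ?x - ys k) + norm (?y - ystar ?x)"
    using norm_triangle_ineq[of "ystar ?x - ys k" "?y - ystar ?x"] by simp
  also have "\<dots> \<le> E + Lyx / \<mu> * norm (?x' - ?x)"
    using assms ystar_lipschitz[OF xs_in[of "Suc k"] xs_in[of k]]
    by (intro add_mono) (auto simp: err_def norm_minus_commute)
  also have "\<dots> \<le> E + Lyx / \<mu> * (\<tau> * DX)"
    using norm_xs_step_le[of k] params L_consts by (intro add_mono mult_left_mono) auto
  finally have dy: "norm (?y - ys k) \<le> E + Lyx * DX * \<tau> / \<mu>" by (simp add: mult_ac)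
  have "norm (gx ?x ?y - gx ?x (ys k)) \<le> Lyx * norm (?y - ys k)"
    using gx_Lipschitz[OF xs_in xs_in y ys_in, of k k] by simp
  also have "\<dots> \<le> Lyx * (E + Lyx * DX * \<tau> / \<mu>)" using dy L_consts by (intro mult_left_mono)
  finally have dg: "norm (gx ?x ?y - gx ?x (ys k)) \<le> Lyx * (E + Lyx * DX * \<tau> / \<mu>)" .
  have "(gx ?x ?y - gx ?x (ys k)) (?x' - ?x) \<le> norm (gx ?x ?y - gx ?x (ys k)) * norm (?x' - ?x)"
    using norm_blinfun[of "gx ?x ?y - gx ?x (ys k)" "?x' - ?x"] by simp
  also have "\<dots> \<le> (Lyx * (E + Lyx * DX * \<tau> / \<mu>)) * (\<tau> * DX)"
    by (intro mult_mono dg norm_xs_step_le norm_ge_zero order_trans[OF norm_ge_zero dg])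
  finally have "gx ?x ?y (?x' - ?x) \<le> gx ?x (ys k) (?x' - ?x)
      + Lyx * (E + Lyx * DX * \<tau> / \<mu>) * (\<tau> * DX)"
    by (simp add: blinfun.diff_left)
  moreover have "Lxx * (norm (?x' - ?x))\<^sup>2 \<le> Lxx * (\<tau> * DX)\<^sup>2"
    using norm_xs_step_le L_consts by (intro mult_left_mono power_mono) auto
  ultimately have "val ?x' - val ?x \<le> - \<tau> * gap_X X gx ?x (ys k)
      + Lyx * (E + Lyx * DX * \<tau> / \<mu>) * (\<tau> * DX) + Lxx * (\<tau> * DX)\<^sup>2"
    using val_diff_le[OF xs_in[of k] xs_in[of "Suc k"]] L_increment_x_le[OF xs_in[of k] xs_in[of "Suc k"] y]
      gx_xs_step_le[of k] by linarith
  then show ?thesis by (simp add: algebra_simps power2_eq_square)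
qed

text \<open>If all gaps were larger, each of the \<open>K - a\<close> steps would lower
  \<open>val\<close> by more than \<open>M * DX / real (K - a)\<close>, in total more than its
  oscillation \<open>M * DX\<close> allows.\<close>

lemma exists_small_gap_X:
  assumes "a < K" and E: "\<And>k. a \<le> k \<Longrightarrow> err k \<le> E"
    and M: "\<And>x y. x \<in> X \<Longrightarrow> y \<in> Y \<Longrightarrow> norm (gx x y) \<le> M"
  shows "\<exists>t\<in>{a..<K}. gap_X X gx (xs t) (ys t)
    \<le> M * DX / (real (K - a) * \<tau>) + (DX * Lyx * (E + Lyx * DX * \<tau> / \<mu>) + Lxx * DX\<^sup>2 * \<tau>)"
proof (rule ccontr)
  define R where "R = DX * Lyx * (E + Lyx * DX * \<tau> / \<mu>) + Lxx * DX\<^sup>2 * \<tau>"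
  let ?G = "\<lambda>t. gap_X X gx (xs t) (ys t)"
  assume "\<not> ?thesis"
  then have big: "?G t > M * DX / (real (K - a) * \<tau>) + R" if "t \<in> {a..<K}" for t
    using that unfolding R_def by force
  have "val (xs (Suc t)) - val (xs t) < - (M * DX / real (K - a))" if "t \<in> {a..<K}" for t
  proof -
    have "\<tau> * (M * DX / (real (K - a) * \<tau>) + R) < \<tau> * ?G t"
      using big[OF that] params by (intro mult_strict_left_mono) auto
    then have "M * DX / real (K - a) + \<tau> * R < \<tau> * ?G t"
      using params by (simp add: distrib_left)
    then show ?thesis using val_descent[OF E, of t] that by (simp add: R_def)
  qed
  then have "(\<Sum>t\<in>{a..<K}. val (xs (Suc t)) - val (xs t)) < (\<Sum>t\<in>{a..<K}. - (M * DX / real (K - a)))"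
    using assms(1) by (intro sum_strict_mono) auto
  also have "\<dots> = - (M * DX)" using assms(1) by simp
  finally have "val (xs K) - val (xs a) < - (M * DX)"
    using assms(1) sum_Suc_diff'[of a K "\<lambda>t. val (xs t)"] by simp
  then show False using val_diff_bound[OF xs_in[of K] xs_in[of a] M] by simp
qed

text \<open>A gradient step that is short does not place \<open>gy\<close> near the normal cone at its starting
  point, only at its end point; so the residual at \<open>ys (Suc k)\<close> is read off from step \<open>k\<close>.\<close>

lemma exists_normal_residual:
  "\<exists>v. norm v \<le> Lyx * DX * \<tau> + 2 * (Lyy + 1 / \<sigma>) * err k + \<mu> * DY
    \<and> (\<forall>z\<in>Y. (gy (xs (Suc k)) (ys (Suc k)) - v) \<bullet> (z - ys (Suc k)) \<le> 0)"
proof -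
  let ?y = "ys k" and ?y' = "ys (Suc k)" and ?g = "gy (xs k) (ys k)"
    and ?g' = "gy (xs (Suc k)) (ys (Suc k))"
  \<comment> \<open>Chosen so that \<open>\<sigma> *\<^sub>R (?g' - v)\<close> is the residual of
    the projection in step \<open>k\<close>, which is normal to \<open>Y\<close> at
    \<open>?y'\<close>.\<close>
  define v where "v = (?g' - ?g) + (1 / \<sigma>) *\<^sub>R (?y' - ?y) + \<mu> *\<^sub>R (?y - ys 0)"
  have "(?g' - v) \<bullet> (z - ?y') \<le> 0" if "z \<in> Y" for z
  proof -
    have "(?y + \<sigma> *\<^sub>R (?g - \<mu> *\<^sub>R (?y - ys 0)) - ?y') \<bullet> (z - ?y') \<le> 0"
      unfolding ys_step[of k] dual_step_def by (rule closest_point_dot[OF Y(1) Y_closed that])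
    also have "?y + \<sigma> *\<^sub>R (?g - \<mu> *\<^sub>R (?y - ys 0)) - ?y' = \<sigma> *\<^sub>R (?g' - v)"
      using params by (simp add: v_def algebra_simps)
    finally show ?thesis using params by (simp add: mult_le_0_iff)
  qed
  moreover have "norm v \<le> Lyx * DX * \<tau> + 2 * (Lyy + 1 / \<sigma>) * err k + \<mu> * DY"
  proof -
    have "norm (?g' - ?g) \<le> Lyx * norm (xs (Suc k) - xs k) + Lyy * norm (?y' - ?y)"
      by (intro gy_Lipschitz xs_in ys_in)
    also have "\<dots> \<le> Lyx * (\<tau> * DX) + Lyy * (2 * err k)"
      using norm_xs_step_le[of k] norm_ys_step_le[of k] L_consts
      by (intro add_mono mult_left_mono) (auto simp: norm_minus_commute)
    finally have "norm (?g' - ?g) \<le> Lyx * (\<tau> * DX) + Lyy * (2 * err k)" .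
    moreover have "norm ((1 / \<sigma>) *\<^sub>R (?y' - ?y)) \<le> 1 / \<sigma> * (2 * err k)"
      using norm_ys_step_le[of k] params by (simp add: norm_minus_commute divide_right_mono)
    moreover have "norm (\<mu> *\<^sub>R (?y - ys 0)) \<le> \<mu> * DY"
      using norm_diff_le_DY[OF ys_in ys_in] params by simp
    ultimately have "norm v \<le> (Lyx * (\<tau> * DX) + Lyy * (2 * err k)) + 1 / \<sigma> * (2 * err k) + \<mu> * DY"
      unfolding v_def by (intro norm_triangle_le add_mono) auto
    then show ?thesis by (simp add: algebra_simps)
  qed
  ultimately show ?thesis by blast
qed

section \<open>Explicit rates, uniform over dual step-sizes at least \<open>s\<close>\<close>

lemma dual_error_scale:
  assumes s: "0 < s" "s \<le> \<sigma>" and k: "0 < b" "b \<le> real k"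
  shows "err k \<le> DY / s * (1 / (b * \<mu>)) + Lyx * DX / s * (\<tau> / \<mu>\<^sup>2)"
proof -
  have "s * (b * \<mu>) \<le> \<sigma> * (k * \<mu>)" using assms params by (intro mult_mono) auto
  then have "DY / (\<sigma> * (k * \<mu>)) \<le> DY / (s * (b * \<mu>))"
    using assms params DY_nonneg by (intro divide_left_mono) auto
  moreover have "Lyx * DX * \<tau> / (\<sigma> * \<mu>\<^sup>2) \<le> Lyx * DX * \<tau> / (s * \<mu>\<^sup>2)"
    using assms params DX_nonneg L_consts by (intro divide_left_mono mult_right_mono) auto
  moreover have "k > 0" using k by linarith
  ultimately show ?thesis using err_le[of k] by (simp add: mult_ac)
qed

text \<open>Since \<open>s * \<mu> \<le> \<sigma> * \<mu> \<le> 1\<close>, both terms can be folded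
  into the dominant scale \<open>\<tau> / \<mu>\<^sup>2\<close>.\<close>

lemma tau_le:
  assumes "0 < s" "s \<le> \<sigma>"
  shows "\<tau> / \<mu> \<le> 1 / s * (\<tau> / \<mu>\<^sup>2)" "\<tau> \<le> 1 / s\<^sup>2 * (\<tau> / \<mu>\<^sup>2)"
proof -
  have sm: "s * \<mu> \<le> 1" using mult_right_mono[OF assms(2), of \<mu>] sigma_mu params by linarith
  then show "\<tau> / \<mu> \<le> 1 / s * (\<tau> / \<mu>\<^sup>2)"
    using assms params by (simp add: field_simps power2_eq_square)
  have "(s * \<mu>)\<^sup>2 \<le> 1" using sm assms params by (intro power_le_one) auto
  then show "\<tau> \<le> 1 / s\<^sup>2 * (\<tau> / \<mu>\<^sup>2)"
    using assms params by (simp add: field_simps)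
qed

text \<open>The four scales come from the primal descent, the initial tracking error, the drift
  together with the discretization of the primal step, and the regularization.\<close>

lemma gap_Z_rate:
  assumes s: "0 < s" "s \<le> \<sigma>" and K: "2 \<le> K"
    and M: "M \<ge> 0" "\<And>x y. x \<in> X \<Longrightarrow> y \<in> Y \<Longrightarrow> norm (gx x y) \<le> M"
  shows "\<exists>t\<in>{nat \<lceil>real K / 2\<rceil>..K - 1}. gap_Z X Y gx gy \<sigma> (xs t) (ys t) \<le>
     3 * M * DX * (1 / (real K * \<tau>)) + (DX * Lyx + 2 / s) * (2 * DY / s) * (1 / (real K * \<mu>))
     + ((DX * Lyx + 2 / s) * (Lyx * DX / s) + DX\<^sup>2 * Lyx\<^sup>2 / s + Lxx * DX\<^sup>2 / s\<^sup>2) * (\<tau> / \<mu>\<^sup>2)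
     + DY * \<mu>"
proof -
  define a where "a = nat \<lceil>real K / 2\<rceil>"
  define E where "E = 2 * DY / s * (1 / (real K * \<mu>)) + Lyx * DX / s * (\<tau> / \<mu>\<^sup>2)"
  have a: "real K / 2 \<le> a" "a < K" using K unfolding a_def by linarith+
  \<comment> \<open>The second half keeps at least a third of the indices; rounding makes
    \<open>K = 2\<close> fit as well, with \<open>a = 1\<close>.\<close>
  have "2 * a \<le> K + 1" unfolding a_def by linarith
  then have "K \<le> 3 * (K - a)" using K by arith
  then have a3: "real K / 3 \<le> real (K - a)" by linarith
  have E0: "E \<ge> 0" unfolding E_def using s params DX_nonneg DY_nonneg L_consts by simp
  have errE: "err k \<le> E" if "a \<le> k" for k
    using dual_error_scale[OF s, of "real K / 2" k] a K that by (simp add: E_def mult.commute[of DY])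
  obtain t where t: "t \<in> {a..<K}" and gX: "gap_X X gx (xs t) (ys t)
      \<le> M * DX / (real (K - a) * \<tau>) + (DX * Lyx * (E + Lyx * DX * \<tau> / \<mu>) + Lxx * DX\<^sup>2 * \<tau>)"
    using exists_small_gap_X[OF a(2) errE M(2)] by blast
  have "M * DX / (real (K - a) * \<tau>) \<le> M * DX / (real K / 3 * \<tau>)"
    using a3 a K params M(1) DX_nonneg by (intro divide_left_mono mult_right_mono) auto
  also have "\<dots> = 3 * M * DX * (1 / (real K * \<tau>))" by simp
  finally have 1: "M * DX / (real (K - a) * \<tau>) \<le> 3 * M * DX * (1 / (real K * \<tau>))" .
  have 2: "DX * Lyx * (Lyx * DX * (\<tau> / \<mu>)) \<le> DX * Lyx * (Lyx * DX * (1 / s * (\<tau> / \<mu>\<^sup>2)))"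
    using tau_le(1)[OF s] DX_nonneg L_consts by (intro mult_left_mono) auto
  have 3: "Lxx * DX\<^sup>2 * \<tau> \<le> Lxx * DX\<^sup>2 * (1 / s\<^sup>2 * (\<tau> / \<mu>\<^sup>2))"
    using tau_le(2)[OF s] L_consts by (intro mult_left_mono) auto
  have "gap_Y Y gy \<sigma> (xs t) (ys t) \<le> 2 / \<sigma> * err t + \<mu> * DY" by (rule gap_Y_le)
  also have "2 / \<sigma> * err t \<le> 2 / s * E"
    using errE[of t] t s params err_nonneg E0 by (intro mult_mono divide_left_mono) auto
  finally have 4: "gap_Y Y gy \<sigma> (xs t) (ys t) \<le> 2 / s * E + \<mu> * DY" by simp
  define w where "w = DX * Lyx + 2 / s"
  have "gap_Z X Y gx gy \<sigma> (xs t) (ys t) \<le> 3 * M * DX * (1 / (real K * \<tau>))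
      + w * E + (DX\<^sup>2 * Lyx\<^sup>2 / s + Lxx * DX\<^sup>2 / s\<^sup>2) * (\<tau> / \<mu>\<^sup>2) + DY * \<mu>"
    using gX 1 2 3 4 by (simp add: gap_Z_def w_def algebra_simps power2_eq_square)
  also have "w * E = w * (2 * DY / s) * (1 / (real K * \<mu>)) + w * (Lyx * DX / s) * (\<tau> / \<mu>\<^sup>2)"
    unfolding E_def by (simp only: distrib_left mult.assoc)
  finally have "gap_Z X Y gx gy \<sigma> (xs t) (ys t) \<le>
     3 * M * DX * (1 / (real K * \<tau>)) + (DX * Lyx + 2 / s) * (2 * DY / s) * (1 / (real K * \<mu>))
     + ((DX * Lyx + 2 / s) * (Lyx * DX / s) + DX\<^sup>2 * Lyx\<^sup>2 / s + Lxx * DX\<^sup>2 / s\<^sup>2) * (\<tau> / \<mu>\<^sup>2)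
     + DY * \<mu>"
    unfolding w_def[symmetric] by (simp only: distrib_right add.assoc)
  moreover have "t \<in> {a..K - 1}" using t by auto
  ultimately show ?thesis unfolding a_def by blast
qed

lemma normal_residual_rate:
  assumes s: "0 < s" "s \<le> \<sigma>" and K: "4 \<le> K" and t: "nat \<lceil>real K / 2\<rceil> \<le> t"
  shows "\<exists>v. norm v \<le> 2 * (Lyy + 1 / s) * (4 * DY / s) * (1 / (real K * \<mu>))
     + (Lyx * DX / s\<^sup>2 + 2 * (Lyy + 1 / s) * (Lyx * DX / s)) * (\<tau> / \<mu>\<^sup>2) + DY * \<mu>
    \<and> (\<forall>z\<in>Y. (gy (xs t) (ys t) - v) \<bullet> (z - ys t) \<le> 0)"
proof -
  \<comment> \<open>The residual at index \<open>t\<close> is read off from the preceding step;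
    \<open>K \<ge> 4\<close> ensures \<open>t - 1 \<ge> K / 4\<close>.\<close>
  obtain k where k: "t = Suc k" using t K by (cases t) auto
  have kK: "real K / 4 \<le> k" using t K k by linarith
  have err: "err k \<le> 4 * DY / s * (1 / (real K * \<mu>)) + Lyx * DX / s * (\<tau> / \<mu>\<^sup>2)" (is "_ \<le> ?E")
    using dual_error_scale[OF s _ kK] K by (simp add: mult.commute[of DY])
  define w where "w = 2 * (Lyy + 1 / s)"
  have "2 * (Lyy + 1 / \<sigma>) * err k \<le> w * ?E"
    unfolding w_def
    using err err_nonneg[of k] s params L_consts by (intro mult_mono add_mono divide_left_mono) auto
  also have "w * ?E = w * (4 * DY / s) * (1 / (real K * \<mu>)) + w * (Lyx * DX / s) * (\<tau> / \<mu>\<^sup>2)"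
    by (simp only: distrib_left mult.assoc)
  finally have 1: "2 * (Lyy + 1 / \<sigma>) * err k \<le> \<dots>" .
  have "Lyx * DX * \<tau> \<le> Lyx * DX * (1 / s\<^sup>2 * (\<tau> / \<mu>\<^sup>2))"
    using tau_le(2)[OF s] L_consts DX_nonneg by (intro mult_left_mono) auto
  then have "Lyx * DX * \<tau> \<le> Lyx * DX / s\<^sup>2 * (\<tau> / \<mu>\<^sup>2)" by simp
  with 1 have le: "Lyx * DX * \<tau> + 2 * (Lyy + 1 / \<sigma>) * err k + \<mu> * DY
      \<le> w * (4 * DY / s) * (1 / (real K * \<mu>))
     + (Lyx * DX / s\<^sup>2 + w * (Lyx * DX / s)) * (\<tau> / \<mu>\<^sup>2) + DY * \<mu>"
    unfolding distrib_right[of "Lyx * DX / s\<^sup>2"] mult.commute[of DY] by linarith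
  then show ?thesis using exists_normal_residual[of k] unfolding k w_def by (meson order_trans)
qed

end

lemma (in saddle_problem) cg_rpga_runI:
  assumes "\<mu> > 0" "\<tau> > 0" "\<tau> \<le> 1" "\<sigma> > 0" "\<sigma> \<le> 2 / (Lyy + 2 * \<mu>)"
    "cg_rpga X Y gx gy \<mu> (\<lambda>_. \<tau>) (\<lambda>_. \<sigma>) xs ys"
  shows "cg_rpga_run X Y L gx gy Lxx Lyx Lyy \<mu> \<tau> \<sigma> xs ys"
proof unfold_locales
  have "Lyy + 2 * \<mu> > 0" using assms(1) L_consts by linarith
  then show "\<sigma> * (Lyy + 2 * \<mu>) \<le> 2" using assms(5) by (simp add: pos_le_divide_eq)
qed (use assms in auto)

lemma lincomb_le_mult_sum:
  fixes a b c d :: real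
  assumes "a \<ge> 0" "b \<ge> 0" "c \<ge> 0" "d \<ge> 0" "p \<ge> 0" "q \<ge> 0" "r \<ge> 0" "s \<ge> 0"
  shows "a * p + b * q + c * r + d * s \<le> (a + b + c + d) * (p + q + r + s)"
  unfolding distrib_right by (intro add_mono mult_left_mono) (use assms in auto)

context saddle_problem
begin

text \<open>The constant is fixed before the parameters and the run, so it depends on the problem
  and \<open>s\<close> alone. One index \<open>t\<close> serves both the gap and the dual
  residual.\<close>

lemma uniform_rate:
  assumes s: "s > 0"
  shows "\<exists>c>0. \<forall>\<mu> \<tau> \<sigma> xs ys K. cg_rpga_run X Y L gx gy Lxx Lyx Lyy \<mu> \<tau> \<sigma> xs ys \<longrightarrow> s \<le> \<sigma> \<longrightarrow> 2 \<le> K \<longrightarrow>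
    (\<exists>t\<in>{nat \<lceil>real K / 2\<rceil>..K - 1}. xs t \<in> X \<and> ys t \<in> Y \<and>
      gap_Z X Y gx gy \<sigma> (xs t) (ys t) \<le> c * (1 / (real K * \<tau>) + 1 / (real K * \<mu>) + \<tau> / \<mu>\<^sup>2 + \<mu>) \<and>
      (4 \<le> K \<longrightarrow> (\<exists>v. norm v \<le> c * (1 / (real K * \<tau>) + 1 / (real K * \<mu>) + \<tau> / \<mu>\<^sup>2 + \<mu>) \<and>
        (\<forall>z\<in>Y. (gy (xs t) (ys t) - v) \<bullet> (z - ys t) \<le> 0))))"
proof -
  obtain M where M: "M \<ge> 0" "\<And>x y. x \<in> X \<Longrightarrow> y \<in> Y \<Longrightarrow> norm (gx x y) \<le> M"
    using gx_bounded by blast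
  define c1 where "c1 = 3 * M * DX"
  define c2 where "c2 = (DX * Lyx + 2 / s) * (2 * DY / s)"
  define c3 where "c3 = (DX * Lyx + 2 / s) * (Lyx * DX / s) + DX\<^sup>2 * Lyx\<^sup>2 / s + Lxx * DX\<^sup>2 / s\<^sup>2"
  define c2' where "c2' = 2 * (Lyy + 1 / s) * (4 * DY / s)"
  define c3' where "c3' = Lyx * DX / s\<^sup>2 + 2 * (Lyy + 1 / s) * (Lyx * DX / s)"
  have nn: "c1 \<ge> 0" "c2 \<ge> 0" "c3 \<ge> 0" "c2' \<ge> 0" "c3' \<ge> 0"
    unfolding c1_def c2_def c3_def c2'_def c3'_def using M(1) DX_nonneg DY_nonneg L_consts s by auto
  \<comment> \<open>The sum dominates both families of constants, and the summand 1 makes it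
    positive.\<close>
  define c where "c = 1 + c1 + c2 + c3 + c2' + c3' + DY"
  have c0: "c > 0" using nn DY_nonneg by (simp add: c_def)
  have "\<exists>t\<in>{nat \<lceil>real K / 2\<rceil>..K - 1}. xs t \<in> X \<and> ys t \<in> Y \<and>
      gap_Z X Y gx gy \<sigma> (xs t) (ys t) \<le> c * (1 / (real K * \<tau>) + 1 / (real K * \<mu>) + \<tau> / \<mu>\<^sup>2 + \<mu>) \<and>
      (4 \<le> K \<longrightarrow> (\<exists>v. norm v \<le> c * (1 / (real K * \<tau>) + 1 / (real K * \<mu>) + \<tau> / \<mu>\<^sup>2 + \<mu>) \<and>
        (\<forall>z\<in>Y. (gy (xs t) (ys t) - v) \<bullet> (z - ys t) \<le> 0)))"
    if run': "cg_rpga_run X Y L gx gy Lxx Lyx Lyy \<mu> \<tau> \<sigma> xs ys" and s\<sigma>: "s \<le> \<sigma>" and K: "2 \<le> K"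
    for \<mu> \<tau> \<sigma> xs ys and K :: nat
  proof -
    interpret cg_rpga_run X Y L gx gy Lxx Lyx Lyy \<mu> \<tau> \<sigma> xs ys by (rule run')
    let ?\<Phi> = "1 / (real K * \<tau>) + 1 / (real K * \<mu>) + \<tau> / \<mu>\<^sup>2 + \<mu>"
    have \<Phi>0: "?\<Phi> \<ge> 0" using params by simp
    have lin: "a * (1 / (real K * \<tau>)) + b * (1 / (real K * \<mu>)) + e * (\<tau> / \<mu>\<^sup>2) + DY * \<mu> \<le> c * ?\<Phi>"
      if "0 \<le> a" "0 \<le> b" "0 \<le> e" "a + b + e + DY \<le> c" for a b e
      using lincomb_le_mult_sum[OF that(1-3) DY_nonneg, of "1 / (real K * \<tau>)" "1 / (real K * \<mu>)" "\<tau> / \<mu>\<^sup>2" \<mu>]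
        mult_right_mono[OF that(4) \<Phi>0] params by (meson divide_nonneg_nonneg less_imp_le mult_nonneg_nonneg
          of_nat_0_le_iff order_trans zero_le_one zero_le_power2)
    obtain t where t: "t \<in> {nat \<lceil>real K / 2\<rceil>..K - 1}" and
      gap: "gap_Z X Y gx gy \<sigma> (xs t) (ys t)
        \<le> c1 * (1 / (real K * \<tau>)) + c2 * (1 / (real K * \<mu>)) + c3 * (\<tau> / \<mu>\<^sup>2) + DY * \<mu>"
      using gap_Z_rate[OF s s\<sigma> K M] unfolding c1_def c2_def c3_def by blast
    have "gap_Z X Y gx gy \<sigma> (xs t) (ys t) \<le> c * ?\<Phi>"
      by (rule order_trans[OF gap lin]) (use nn in \<open>auto simp: c_def\<close>)
    moreover have "\<exists>v. norm v \<le> c * ?\<Phi> \<and> (\<forall>z\<in>Y. (gy (xs t) (ys t) - v) \<bullet> (z - ys t) \<le> 0)" if K4: "4 \<le> K"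
    proof -
      have "nat \<lceil>real K / 2\<rceil> \<le> t" using t by simp
      from normal_residual_rate[OF s s\<sigma> K4 this]
      obtain v where v: "norm v \<le> c2' * (1 / (real K * \<mu>)) + c3' * (\<tau> / \<mu>\<^sup>2) + DY * \<mu>"
        "\<forall>z\<in>Y. (gy (xs t) (ys t) - v) \<bullet> (z - ys t) \<le> 0"
        unfolding c2'_def c3'_def by blast
      have "norm v \<le> c * ?\<Phi>"
        using v(1) lin[of 0 c2' c3'] nn by (simp add: c_def)
      then show ?thesis using v(2) by blast
    qed
    ultimately show ?thesis using t xs_in ys_in by blast
  qed
  with c0 show ?thesis by blast
qed

end

subsection \<open>Approximate stationarity\<close>

lemma eps_subdifferential_indicator_iff:
  "\<xi> \<in> eps_subdifferential \<eta> (indicator_fn S) x \<longleftrightarrow> x \<in> S \<and> (\<forall>z\<in>S. \<xi> (z - x) \<le> \<eta>)"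
  by (auto simp: eps_subdifferential_def indicator_fn_def)

lemma dual_inclusionI:
  assumes "y \<in> Y" "\<forall>z\<in>Y. (g - v) \<bullet> (z - y) \<le> 0"
  shows "blinfun_inner_right g
    \<in> {\<xi> + blinfun_inner_right v |\<xi>. \<xi> \<in> subdifferential (indicator_fn Y) y}"
proof -
  have "blinfun_inner_right (g - v) \<in> subdifferential (indicator_fn Y) y"
    using assms by (simp add: subdifferential_def eps_subdifferential_indicator_iff)
  moreover have "blinfun_inner_right g = blinfun_inner_right (g - v) + blinfun_inner_right v"
    by (rule blinfun_eqI) (simp add: blinfun.add_left inner_diff_left)
  ultimately show ?thesis by blast
qed

text \<open>A bound on the gap is already an \<eta>-normality statement, so the residual can be
  0.\<close>

lemma primal_approx_inclusionI:
  fixes \<phi> :: "'a::real_normed_vector \<Rightarrow>\<^sub>L real"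
  assumes "x \<in> X" "\<forall>z\<in>X. \<phi> (x - z) \<le> \<eta>"
  shows "- \<phi> \<in> {\<xi> + 0 |\<xi>. \<xi> \<in> eps_subdifferential \<eta> (indicator_fn X) x}"
  using assms by (auto simp: eps_subdifferential_indicator_iff blinfun.minus_left blinfun.diff_right)

lemma zero_in_subdifferential_indicator:
  "x \<in> X \<Longrightarrow> 0 \<in> subdifferential (indicator_fn X) x"
  by (simp add: subdifferential_def eps_subdifferential_indicator_iff)

text \<open>Testing with \<open>x - w\<close> for \<open>w\<close> of norm \<rho> and both signs of
  \<open>w\<close> bounds the functional on a sphere. Inside \<open>X\<close> a small gap thus
  forces a small gradient.\<close>

lemma norm_blinfun_le_of_cball:
  fixes \<phi> :: "'a::real_normed_vector \<Rightarrow>\<^sub>L real"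
  assumes "\<rho> > 0" "cball x \<rho> \<subseteq> X" "\<forall>z\<in>X. \<phi> (x - z) \<le> \<eta>"
  shows "norm \<phi> \<le> \<eta> / \<rho>"
proof -
  have bound: "\<phi> w \<le> \<eta>" if "norm w \<le> \<rho>" for w
    using assms(2,3) that by (auto dest!: bspec[of _ _ "x - w"] simp: subset_iff dist_norm)
  have \<eta>: "\<eta> \<ge> 0" using bound[of 0] assms(1) by simp
  have "\<bar>\<phi> w\<bar> \<le> \<eta> / \<rho> * norm w" for w
  proof (cases "w = 0")
    case False
    have "\<phi> ((\<rho> / norm w) *\<^sub>R w) \<le> \<eta>" "\<phi> (- ((\<rho> / norm w) *\<^sub>R w)) \<le> \<eta>"
      using False assms(1) by (auto intro!: bound)
    then have "\<bar>(\<rho> / norm w) * \<phi> w\<bar> \<le> \<eta>"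
      by (simp add: blinfun.scaleR_right blinfun.minus_right abs_le_iff)
    then show ?thesis using False assms(1) by (simp add: abs_mult field_simps)
  qed simp
  then show ?thesis using \<eta> assms(1) by (intro norm_blinfun_bound) auto
qed

lemma (in saddle_problem) stationary_of_gap_and_residual:
  assumes x: "x \<in> X" and y: "y \<in> Y" and gap: "gap_Z X Y gx gy \<sigma> x y \<le> \<epsilon>" and \<sigma>: "\<sigma> > 0" and \<epsilon>: "\<epsilon> > 0"
    and v: "norm v \<le> \<epsilon>" "\<forall>z\<in>Y. (gy x y - v) \<bullet> (z - y) \<le> 0"
  shows "approx_game_stationary X Y gx gy \<epsilon> (1 * \<epsilon>) x y"
    and "\<rho> > 0 \<Longrightarrow> cball x \<rho> \<subseteq> X \<Longrightarrow> game_stationary X Y gx gy ((1 + 1 / \<rho>) * \<epsilon>) x y"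
proof -
  have "gap_Y Y gy \<sigma> x y \<ge> 0" using \<sigma> by (simp add: gap_Y_def)
  then have gX: "\<forall>z\<in>X. gx x y (x - z) \<le> \<epsilon>"
    using gap gap_X_upper[OF x, of _ y] by (fastforce simp: gap_Z_def)
  show "approx_game_stationary X Y gx gy \<epsilon> (1 * \<epsilon>) x y"
    unfolding approx_game_stationary_def
  proof (intro conjI)
    show "\<exists>u. norm u \<le> 1 * \<epsilon> \<and> - gx x y \<in> {\<xi> + u |\<xi>. \<xi> \<in> eps_subdifferential \<epsilon> (indicator_fn X) x}"
      using primal_approx_inclusionI[OF x gX] \<epsilon> by (intro exI[of _ 0] conjI) auto
    show "\<exists>v. norm v \<le> 1 * \<epsilon> \<and> blinfun_inner_right (gy x y)
        \<in> {\<xi> + blinfun_inner_right v |\<xi>. \<xi> \<in> subdifferential (indicator_fn Y) y}"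
      using dual_inclusionI[OF y v(2)] v(1) by (intro exI[of _ v] conjI) auto
  qed fact+
  assume \<rho>: "\<rho> > 0" "cball x \<rho> \<subseteq> X"
  have le: "\<epsilon> / \<rho> \<le> (1 + 1 / \<rho>) * \<epsilon>" "\<epsilon> \<le> (1 + 1 / \<rho>) * \<epsilon>" using \<epsilon> \<rho>(1) by (auto simp: field_simps)
  have u: "norm (- gx x y) \<le> (1 + 1 / \<rho>) * \<epsilon>"
    using norm_blinfun_le_of_cball[OF \<rho> gX] le by simp
  \<comment> \<open>The subgradient is 0 and the residual is the whole gradient, whose norm is
    already small.\<close>
  have "- gx x y \<in> {\<xi> + - gx x y |\<xi>. \<xi> \<in> subdifferential (indicator_fn X) x}"
    using zero_in_subdifferential_indicator[OF x] by force
  then show "game_stationary X Y gx gy ((1 + 1 / \<rho>) * \<epsilon>) x y"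
    unfolding game_stationary_def
    using x y u dual_inclusionI[OF y v(2)] order_trans[OF v(1) le(2)] by blast
qed

subsection \<open>Choice of the parameters\<close>

text \<open>Everything rests on \<open>real K * \<epsilon> ^ 4 = 1\<close>. The term with
  \<open>\<mu>\<close> in the denominator is of order \<open>\<epsilon> ^ 3\<close>, hence of order
  \<epsilon> because \<open>\<epsilon> \<le> 1\<close>.\<close>

lemma rate_horizon_scaling:
  fixes \<epsilon> m\<^sub>1 m\<^sub>2 r\<^sub>1 r\<^sub>2 \<mu> \<tau> :: real
  assumes K: "K > 0" and \<epsilon>: "\<epsilon> = 1 / real K powr (1/4)"
    and pos: "m\<^sub>1 > 0" "r\<^sub>1 > 0" "r\<^sub>2 > 0"
    and \<mu>: "m\<^sub>1 * \<epsilon> \<le> \<mu>" "\<mu> \<le> m\<^sub>2 * \<epsilon>" and \<tau>: "r\<^sub>1 * \<epsilon> ^ 3 \<le> \<tau>" "\<tau> \<le> r\<^sub>2 * \<epsilon> ^ 3"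
  shows "1 / (real K * \<tau>) + 1 / (real K * \<mu>) + \<tau> / \<mu>\<^sup>2 + \<mu>
    \<le> (1 / r\<^sub>1 + 1 / m\<^sub>1 + r\<^sub>2 / m\<^sub>1\<^sup>2 + m\<^sub>2) * \<epsilon>"
proof -
  have e: "\<epsilon> > 0" "\<epsilon> \<le> 1" using K \<epsilon> by (auto simp: ge_one_powr_ge_zero)
  have pos': "\<mu> > 0" "\<tau> > 0"
    using e pos \<mu>(1) \<tau>(1) by (auto intro: less_le_trans[rotated])
  have "(real K powr (1/4)) ^ 4 = real K" using K by (simp add: powr_power)
  then have e4: "real K * \<epsilon> ^ 4 = 1" using K by (simp add: \<epsilon> power_one_over)
  have "real K * (r\<^sub>1 * \<epsilon> ^ 3) \<le> real K * \<tau>" using \<tau> by (intro mult_left_mono) auto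
  then have "1 / (real K * \<tau>) \<le> 1 / (real K * (r\<^sub>1 * \<epsilon> ^ 3))"
    using e pos pos' K by (intro divide_left_mono) auto
  also have "\<dots> = (real K * \<epsilon> ^ 4) / (real K * (r\<^sub>1 * \<epsilon> ^ 3))" by (simp only: e4)
  also have "\<dots> = 1 / r\<^sub>1 * \<epsilon>" using e K by (simp add: power_numeral_reduce)
  finally have 1: "1 / (real K * \<tau>) \<le> 1 / r\<^sub>1 * \<epsilon>" .
  have "real K * (m\<^sub>1 * \<epsilon>) \<le> real K * \<mu>" using \<mu> by (intro mult_left_mono) auto
  then have "1 / (real K * \<mu>) \<le> 1 / (real K * (m\<^sub>1 * \<epsilon>))"
    using e pos pos' K by (intro divide_left_mono) auto
  also have "\<dots> = (real K * \<epsilon> ^ 4) / (real K * (m\<^sub>1 * \<epsilon>))" by (simp only: e4)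
  also have "\<dots> = 1 / m\<^sub>1 * \<epsilon> ^ 3" using e K by (simp add: power_numeral_reduce)
  also have "\<dots> \<le> 1 / m\<^sub>1 * \<epsilon>"
    using e pos power_decreasing[of 1 3 \<epsilon>] by (intro mult_left_mono) auto
  finally have 2: "1 / (real K * \<mu>) \<le> 1 / m\<^sub>1 * \<epsilon>" .
  have "\<tau> / \<mu>\<^sup>2 \<le> (r\<^sub>2 * \<epsilon> ^ 3) / (m\<^sub>1 * \<epsilon>)\<^sup>2"
    using e pos \<mu> \<tau> by (intro frac_le power_mono) auto
  also have "\<dots> = r\<^sub>2 / m\<^sub>1\<^sup>2 * \<epsilon>" using e by (simp add: power_mult_distrib power_numeral_reduce)
  finally show ?thesis using 1 2 \<mu>(2) by (simp add: distrib_right)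
qed

text \<open>Each of the four terms gets the share \<open>\<epsilon> / 4\<close>: \<open>m\<close>
  and \<open>r\<close> are small enough for the two free of \<open>K\<close>, and the first two
  summands of the bound on \<open>K\<close> serve the others. The third summand yields
  \<open>4 \<le> K\<close>.\<close>

lemma rate_accuracy_scaling:
  fixes \<epsilon> m r c s :: real
  assumes pos: "c > 0" "m > 0" "r > 0" "s > 0" "\<epsilon> > 0"
    and m: "m \<le> 1 / (4 * c)" and r: "r \<le> m\<^sup>2 / (4 * c)" and \<epsilon>: "s * (m * \<epsilon>) \<le> 1"
    and K: "real K \<ge> (4 * c / r + 4 * c / (m ^ 3 * s\<^sup>2) + 4 / (m * s) ^ 4) / \<epsilon> ^ 4"
  shows "4 \<le> K"
    and "c * (1 / (real K * (r * \<epsilon> ^ 3)) + 1 / (real K * (m * \<epsilon>)) + (r * \<epsilon> ^ 3) / (m * \<epsilon>)\<^sup>2 + m * \<epsilon>) \<le> \<epsilon>"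
proof -
  have sum: "4 * c / r + 4 * c / (m ^ 3 * s\<^sup>2) + 4 / (m * s) ^ 4 \<le> real K * \<epsilon> ^ 4"
    using K pos by (simp add: pos_divide_le_eq)
  have nn: "0 < 4 * c / r" "0 < 4 * c / (m ^ 3 * s\<^sup>2)" "0 < 4 / (m * s) ^ 4" using pos by auto
  have K1: "4 * c / r \<le> real K * \<epsilon> ^ 4" and K2: "4 * c / (m ^ 3 * s\<^sup>2) \<le> real K * \<epsilon> ^ 4"
    and K3: "4 / (m * s) ^ 4 \<le> real K * \<epsilon> ^ 4" using sum nn by linarith+
  have "4 \<le> real K * \<epsilon> ^ 4 * (m * s) ^ 4" using K3 pos by (simp add: pos_divide_le_eq)
  also have "\<dots> = real K * (s * (m * \<epsilon>)) ^ 4" by (simp add: power_mult_distrib mult_ac)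
  also have "\<dots> \<le> real K * 1" using pos \<epsilon> by (intro mult_left_mono power_le_one) auto
  finally show "4 \<le> K" by simp
  then have K0: "real K > 0" by simp
  have "4 * c \<le> real K * \<epsilon> ^ 4 * r" using K1 pos by (simp add: pos_divide_le_eq)
  also have "\<dots> = \<epsilon> * (real K * (r * \<epsilon> ^ 3))" by (simp add: power_numeral_reduce)
  finally have 1: "c * (1 / (real K * (r * \<epsilon> ^ 3))) \<le> \<epsilon> / 4"
    using K0 pos by (simp add: pos_divide_le_eq)
  \<comment> \<open>Here \<epsilon> may exceed 1, so the surplus factor is bounded through
    \<open>s * (m * \<epsilon>) \<le> 1\<close> instead.\<close>
  have "4 * c \<le> real K * \<epsilon> ^ 4 * (m ^ 3 * s\<^sup>2)" using K2 pos by (simp add: pos_divide_le_eq)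
  also have "\<dots> = \<epsilon> * (real K * (m * \<epsilon>)) * (s * (m * \<epsilon>))\<^sup>2"
    by (simp add: power_numeral_reduce)
  also have "\<dots> \<le> \<epsilon> * (real K * (m * \<epsilon>)) * 1"
    using pos \<epsilon> by (intro mult_left_mono power_le_one) auto
  finally have 2: "c * (1 / (real K * (m * \<epsilon>))) \<le> \<epsilon> / 4"
    using K0 pos by (simp add: pos_divide_le_eq)
  have "c * ((r * \<epsilon> ^ 3) / (m * \<epsilon>)\<^sup>2) = (c * r / m\<^sup>2) * \<epsilon>"
    using pos by (simp add: power_numeral_reduce)
  also have "\<dots> \<le> 1 / 4 * \<epsilon>" using r pos by (intro mult_right_mono) (auto simp: field_simps)
  finally have 3: "c * ((r * \<epsilon> ^ 3) / (m * \<epsilon>)\<^sup>2) \<le> \<epsilon> / 4" by simp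
  have "c * m \<le> 1 / 4" using m pos by (simp add: field_simps)
  then have "c * (m * \<epsilon>) \<le> \<epsilon> / 4" using mult_right_mono[of "c * m" "1 / 4" \<epsilon>] pos by simp
  then show "c * (1 / (real K * (r * \<epsilon> ^ 3)) + 1 / (real K * (m * \<epsilon>)) + (r * \<epsilon> ^ 3) / (m * \<epsilon>)\<^sup>2 + m * \<epsilon>) \<le> \<epsilon>"
    using 1 2 3 unfolding distrib_left by linarith
qed

text \<open>The order of quantifiers makes the constants independent of \<epsilon>, \<open>K\<close>
  and the run, with \<open>\<sigma>\<^sub>0\<close> bounding the dual step-sizes from below. The
  first part starts at \<open>K = 2\<close> because the index range is empty for
  \<open>K = 1\<close>. The last clause gives exact stationarity with a constant depending on the
  distance of \<open>xs t\<close> to the boundary of \<open>X\<close>.\<close>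

theorem corollary5p2:
  fixes X :: "'a::real_normed_vector set" and Y :: "'b::euclidean_space set"
    and B :: "'a set"
    and L :: "'a \<Rightarrow> 'b \<Rightarrow> real"
    and gx :: "'a \<Rightarrow> 'b \<Rightarrow> 'a \<Rightarrow>\<^sub>L real" and gy :: "'a \<Rightarrow> 'b \<Rightarrow> 'b"
    and Lxx Lyx Lyy \<sigma>\<^sub>0 :: real
  assumes fin_dim: "finite B" "span B = UNIV"
    and X: "convex X" "compact X" and Y: "convex Y" "compact Y"
    and L_consts: "Lxx \<ge> 0" "Lyx > 0" "Lyy \<ge> 0"
    and gx_deriv: "\<And>x y. y \<in> Y \<Longrightarrow> ((\<lambda>x. L x y) has_derivative blinfun_apply (gx x y)) (at x)"
    and gx_cont: "\<And>y. y \<in> Y \<Longrightarrow> continuous_on UNIV (\<lambda>x. gx x y)"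
    and gx_Lipschitz: "\<And>x x' y y'. x \<in> X \<Longrightarrow> x' \<in> X \<Longrightarrow> y \<in> Y \<Longrightarrow> y' \<in> Y \<Longrightarrow>
          norm (gx x y - gx x' y') \<le> Lxx * norm (x - x') + Lyx * norm (y - y')"
    and concave: "\<And>x. x \<in> X \<Longrightarrow> concave_on UNIV (L x)"
    and gy_deriv: "\<And>x y. x \<in> X \<Longrightarrow> GDERIV (L x) y :> gy x y"
    and gy_cont: "\<And>x. x \<in> X \<Longrightarrow> continuous_on UNIV (gy x)"
    and gy_Lipschitz: "\<And>x x' y y'. x \<in> X \<Longrightarrow> x' \<in> X \<Longrightarrow> y \<in> Y \<Longrightarrow> y' \<in> Y \<Longrightarrow>
          norm (gy x y - gy x' y') \<le> Lyx * norm (x - x') + Lyy * norm (y - y')"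
    and \<sigma>\<^sub>0: "\<sigma>\<^sub>0 > 0"
  shows
    "(\<forall>m\<^sub>1>0. \<forall>m\<^sub>2>0. \<forall>r\<^sub>1>0. \<forall>r\<^sub>2>0. \<exists>C>0.
       \<forall>(K::nat)\<ge>2. \<forall>\<epsilon> \<mu> \<tau> \<sigma> xs ys.
         \<epsilon> = 1 / real K powr (1/4) \<and>
         m\<^sub>1 * \<epsilon> \<le> \<mu> \<and> \<mu> \<le> m\<^sub>2 * \<epsilon> \<and> r\<^sub>1 * \<epsilon> ^ 3 \<le> \<tau> \<and> \<tau> \<le> r\<^sub>2 * \<epsilon> ^ 3 \<and> \<tau> \<le> 1 \<and>
         \<sigma>\<^sub>0 \<le> \<sigma> \<and> \<sigma> \<le> 2 / (Lyy + 2 * \<mu>) \<and>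
         cg_rpga X Y gx gy \<mu> (\<lambda>_. \<tau>) (\<lambda>_. \<sigma>) xs ys \<longrightarrow>
         (\<exists>t\<in>{nat \<lceil>real K / 2\<rceil>..K - 1}. xs t \<in> X \<and> ys t \<in> Y \<and>
            gap_Z X Y gx gy \<sigma> (xs t) (ys t) \<le> C / real K powr (1/4)))
     \<and>
     (\<exists>m\<^sub>0>0. \<forall>m. 0 < m \<and> m \<le> m\<^sub>0 \<longrightarrow> (\<exists>r\<^sub>0>0. \<forall>r. 0 < r \<and> r \<le> r\<^sub>0 \<longrightarrow> (\<exists>C>0. \<exists>D>0.
       \<forall>\<epsilon>>0. \<forall>\<mu> \<tau> \<sigma> xs ys.
         \<mu> = m * \<epsilon> \<and> \<tau> = r * \<epsilon> ^ 3 \<and> \<tau> \<le> 1 \<and>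
         \<sigma>\<^sub>0 \<le> \<sigma> \<and> \<sigma> \<le> 2 / (Lyy + 2 * \<mu>) \<and>
         cg_rpga X Y gx gy \<mu> (\<lambda>_. \<tau>) (\<lambda>_. \<sigma>) xs ys \<longrightarrow>
         (\<forall>K::nat. real K \<ge> C / \<epsilon> ^ 4 \<longrightarrow>
           (\<exists>t\<in>{nat \<lceil>real K / 2\<rceil>..K - 1}. xs t \<in> X \<and> ys t \<in> Y \<and>
              gap_Z X Y gx gy \<sigma> (xs t) (ys t) \<le> \<epsilon> \<and>
              approx_game_stationary X Y gx gy \<epsilon> (D * \<epsilon>) (xs t) (ys t) \<and>
              (\<forall>\<rho>>0. cball (xs t) \<rho> \<subseteq> X \<longrightarrow>
                 game_stationary X Y gx gy ((D + 1 / \<rho>) * \<epsilon>) (xs t) (ys t)))))))"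
proof -
  interpret saddle_problem X Y L gx gy Lxx Lyx Lyy
    using assms compact_imp_bounded by unfold_locales auto
  let ?\<Phi> = "\<lambda>(K::nat) \<tau> \<mu>. 1 / (real K * \<tau>) + 1 / (real K * \<mu>) + \<tau> / \<mu>\<^sup>2 + \<mu>"
  obtain c where c: "c > 0" and rate:
    "\<And>\<mu> \<tau> \<sigma> xs ys K. cg_rpga_run X Y L gx gy Lxx Lyx Lyy \<mu> \<tau> \<sigma> xs ys \<Longrightarrow> \<sigma>\<^sub>0 \<le> \<sigma> \<Longrightarrow> 2 \<le> K \<Longrightarrow>
      \<exists>t\<in>{nat \<lceil>real K / 2\<rceil>..K - 1}. xs t \<in> X \<and> ys t \<in> Y \<and>
        gap_Z X Y gx gy \<sigma> (xs t) (ys t) \<le> c * ?\<Phi> K \<tau> \<mu> \<and>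
        (4 \<le> K \<longrightarrow> (\<exists>v. norm v \<le> c * ?\<Phi> K \<tau> \<mu> \<and>
          (\<forall>z\<in>Y. (gy (xs t) (ys t) - v) \<bullet> (z - ys t) \<le> 0)))"
    using uniform_rate[OF \<sigma>\<^sub>0] by blast
  show ?thesis
  proof (rule conjI; (intro allI impI)?)
    fix m1 m2 r1 r2 :: real
    assume pos: "0 < m1" "0 < m2" "0 < r1" "0 < r2"
    define C where "C = c * (1 / r1 + 1 / m1 + r2 / m1\<^sup>2 + m2)"
    have "C > 0" using pos c by (simp add: C_def add_pos_pos)
    moreover have "\<exists>t\<in>{nat \<lceil>real K / 2\<rceil>..K - 1}. xs t \<in> X \<and> ys t \<in> Y \<and>
        gap_Z X Y gx gy \<sigma> (xs t) (ys t) \<le> C / real K powr (1/4)"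
      if K: "2 \<le> K" and h: "\<epsilon> = 1 / real K powr (1/4) \<and>
         m1 * \<epsilon> \<le> \<mu> \<and> \<mu> \<le> m2 * \<epsilon> \<and> r1 * \<epsilon> ^ 3 \<le> \<tau> \<and> \<tau> \<le> r2 * \<epsilon> ^ 3 \<and> \<tau> \<le> 1 \<and>
         \<sigma>\<^sub>0 \<le> \<sigma> \<and> \<sigma> \<le> 2 / (Lyy + 2 * \<mu>) \<and>
         cg_rpga X Y gx gy \<mu> (\<lambda>_. \<tau>) (\<lambda>_. \<sigma>) xs ys" for K :: nat and \<epsilon> \<mu> \<tau> \<sigma> xs ys
    proof -
      have "\<epsilon> > 0" using h K by simp
      then have "m1 * \<epsilon> > 0" "r1 * \<epsilon> ^ 3 > 0" using pos by auto
      then have run: "cg_rpga_run X Y L gx gy Lxx Lyx Lyy \<mu> \<tau> \<sigma> xs ys"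
        using h \<sigma>\<^sub>0 by (intro cg_rpga_runI) auto
      have "c * ?\<Phi> K \<tau> \<mu> \<le> c * ((1 / r1 + 1 / m1 + r2 / m1\<^sup>2 + m2) * \<epsilon>)"
        using h pos K c by (intro mult_left_mono rate_horizon_scaling) auto
      also have "\<dots> = C / real K powr (1/4)" using h by (simp add: C_def)
      finally have "c * ?\<Phi> K \<tau> \<mu> \<le> C / real K powr (1/4)" .
      with rate[OF run _ K] h show ?thesis by (meson order_trans)
    qed
    ultimately show "\<exists>C>0. \<forall>K\<ge>2. \<forall>\<epsilon> \<mu> \<tau> \<sigma> xs ys.
         \<epsilon> = 1 / real K powr (1/4) \<and>
         m1 * \<epsilon> \<le> \<mu> \<and> \<mu> \<le> m2 * \<epsilon> \<and> r1 * \<epsilon> ^ 3 \<le> \<tau> \<and> \<tau> \<le> r2 * \<epsilon> ^ 3 \<and> \<tau> \<le> 1 \<and>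
         \<sigma>\<^sub>0 \<le> \<sigma> \<and> \<sigma> \<le> 2 / (Lyy + 2 * \<mu>) \<and>
         cg_rpga X Y gx gy \<mu> (\<lambda>_. \<tau>) (\<lambda>_. \<sigma>) xs ys \<longrightarrow>
         (\<exists>t\<in>{nat \<lceil>real K / 2\<rceil>..K - 1}. xs t \<in> X \<and> ys t \<in> Y \<and>
            gap_Z X Y gx gy \<sigma> (xs t) (ys t) \<le> C / real K powr (1/4))"
      by blast
  next
    have main: "\<exists>t\<in>{nat \<lceil>real K / 2\<rceil>..K - 1}. xs t \<in> X \<and> ys t \<in> Y \<and>
              gap_Z X Y gx gy \<sigma> (xs t) (ys t) \<le> \<epsilon> \<and>
              approx_game_stationary X Y gx gy \<epsilon> (1 * \<epsilon>) (xs t) (ys t) \<and>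
              (\<forall>\<rho>>0. cball (xs t) \<rho> \<subseteq> X \<longrightarrow>
                 game_stationary X Y gx gy ((1 + 1 / \<rho>) * \<epsilon>) (xs t) (ys t))"
      if m: "0 < m" "m \<le> 1 / (4 * c)" and r: "0 < r" "r \<le> m\<^sup>2 / (4 * c)" and \<epsilon>: "\<epsilon> > 0"
        and h: "\<mu> = m * \<epsilon> \<and> \<tau> = r * \<epsilon> ^ 3 \<and> \<tau> \<le> 1 \<and>
         \<sigma>\<^sub>0 \<le> \<sigma> \<and> \<sigma> \<le> 2 / (Lyy + 2 * \<mu>) \<and>
         cg_rpga X Y gx gy \<mu> (\<lambda>_. \<tau>) (\<lambda>_. \<sigma>) xs ys"
        and K: "real K \<ge> (4 * c / r + 4 * c / (m ^ 3 * \<sigma>\<^sub>0\<^sup>2) + 4 / (m * \<sigma>\<^sub>0) ^ 4) / \<epsilon> ^ 4"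
      for m r \<epsilon> \<mu> \<tau> \<sigma> xs ys and K :: nat
    proof -
      have run: "cg_rpga_run X Y L gx gy Lxx Lyx Lyy \<mu> \<tau> \<sigma> xs ys"
        using h \<sigma>\<^sub>0 m r \<epsilon> by (intro cg_rpga_runI) auto
      have \<sigma>: "\<sigma> > 0" using h \<sigma>\<^sub>0 by linarith
      \<comment> \<open>The step-size condition implicitly limits \<epsilon>, which replaces an
        assumption \<open>\<epsilon> \<le> 1\<close>.\<close>
      have "\<sigma>\<^sub>0 * (m * \<epsilon>) \<le> \<sigma> * \<mu>" using h m \<epsilon> by simp
      also have "\<dots> \<le> 1" by (rule cg_rpga_run.sigma_mu(2)[OF run])
      finally have s: "\<sigma>\<^sub>0 * (m * \<epsilon>) \<le> 1" .
      note sc = rate_accuracy_scaling[OF c m(1) r(1) \<sigma>\<^sub>0 \<epsilon> m(2) r(2) s K]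
      have \<Phi>: "c * ?\<Phi> K \<tau> \<mu> \<le> \<epsilon>" using sc(2) h by simp
      have K2: "2 \<le> K" using sc(1) by simp
      obtain t v where t: "t \<in> {nat \<lceil>real K / 2\<rceil>..K - 1}" "xs t \<in> X" "ys t \<in> Y"
        and gap: "gap_Z X Y gx gy \<sigma> (xs t) (ys t) \<le> c * ?\<Phi> K \<tau> \<mu>"
        and v: "norm v \<le> c * ?\<Phi> K \<tau> \<mu>" "\<forall>z\<in>Y. (gy (xs t) (ys t) - v) \<bullet> (z - ys t) \<le> 0"
        using rate[OF run _ K2] h sc(1) by blast
      note st = stationary_of_gap_and_residual[OF t(2,3) order_trans[OF gap \<Phi>] \<sigma> \<epsilon> order_trans[OF v(1) \<Phi>] v(2)]
      show ?thesis using t st order_trans[OF gap \<Phi>] by blast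
    qed
    show "\<exists>m\<^sub>0>0. \<forall>m. 0 < m \<and> m \<le> m\<^sub>0 \<longrightarrow> (\<exists>r\<^sub>0>0. \<forall>r. 0 < r \<and> r \<le> r\<^sub>0 \<longrightarrow> (\<exists>C>0. \<exists>D>0.
       \<forall>\<epsilon>>0. \<forall>\<mu> \<tau> \<sigma> xs ys.
         \<mu> = m * \<epsilon> \<and> \<tau> = r * \<epsilon> ^ 3 \<and> \<tau> \<le> 1 \<and>
         \<sigma>\<^sub>0 \<le> \<sigma> \<and> \<sigma> \<le> 2 / (Lyy + 2 * \<mu>) \<and>
         cg_rpga X Y gx gy \<mu> (\<lambda>_. \<tau>) (\<lambda>_. \<sigma>) xs ys \<longrightarrow>
         (\<forall>K::nat. real K \<ge> C / \<epsilon> ^ 4 \<longrightarrow>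
           (\<exists>t\<in>{nat \<lceil>real K / 2\<rceil>..K - 1}. xs t \<in> X \<and> ys t \<in> Y \<and>
              gap_Z X Y gx gy \<sigma> (xs t) (ys t) \<le> \<epsilon> \<and>
              approx_game_stationary X Y gx gy \<epsilon> (D * \<epsilon>) (xs t) (ys t) \<and>
              (\<forall>\<rho>>0. cball (xs t) \<rho> \<subseteq> X \<longrightarrow>
                 game_stationary X Y gx gy ((D + 1 / \<rho>) * \<epsilon>) (xs t) (ys t))))))"
    \<comment> \<open>This bound on \<open>m\<close> keeps \<open>c * \<mu>\<close> below
      \<open>\<epsilon> / 4\<close>.\<close>
    proof (rule exI[of _ "1 / (4 * c)"], rule conjI, use c in simp, intro allI impI)
      fix m assume m: "0 < m \<and> m \<le> 1 / (4 * c)"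
      let ?C = "\<lambda>r. 4 * c / r + 4 * c / (m ^ 3 * \<sigma>\<^sub>0\<^sup>2) + 4 / (m * \<sigma>\<^sub>0) ^ 4"
      have C: "0 < ?C r" if "0 < r" for r using that c m \<sigma>\<^sub>0 by (simp add: add_pos_pos)
      show "\<exists>r\<^sub>0>0. \<forall>r. 0 < r \<and> r \<le> r\<^sub>0 \<longrightarrow> (\<exists>C>0. \<exists>D>0.
       \<forall>\<epsilon>>0. \<forall>\<mu> \<tau> \<sigma> xs ys.
         \<mu> = m * \<epsilon> \<and> \<tau> = r * \<epsilon> ^ 3 \<and> \<tau> \<le> 1 \<and>
         \<sigma>\<^sub>0 \<le> \<sigma> \<and> \<sigma> \<le> 2 / (Lyy + 2 * \<mu>) \<and>
         cg_rpga X Y gx gy \<mu> (\<lambda>_. \<tau>) (\<lambda>_. \<sigma>) xs ys \<longrightarrow>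
         (\<forall>K::nat. real K \<ge> C / \<epsilon> ^ 4 \<longrightarrow>
           (\<exists>t\<in>{nat \<lceil>real K / 2\<rceil>..K - 1}. xs t \<in> X \<and> ys t \<in> Y \<and>
              gap_Z X Y gx gy \<sigma> (xs t) (ys t) \<le> \<epsilon> \<and>
              approx_game_stationary X Y gx gy \<epsilon> (D * \<epsilon>) (xs t) (ys t) \<and>
              (\<forall>\<rho>>0. cball (xs t) \<rho> \<subseteq> X \<longrightarrow>
                 game_stationary X Y gx gy ((D + 1 / \<rho>) * \<epsilon>) (xs t) (ys t)))))"
      \<comment> \<open>This bound on \<open>r\<close> keeps
        \<open>c * (\<tau> / \<mu>\<^sup>2)\<close> below \<open>\<epsilon> / 4\<close>; it depends
        on \<open>m\<close>, hence the nesting.\<close>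
      proof (rule exI[of _ "m\<^sup>2 / (4 * c)"], rule conjI, use m c in simp, intro allI impI)
        fix r assume r: "0 < r \<and> r \<le> m\<^sup>2 / (4 * c)"
        show "\<exists>C>0. \<exists>D>0.
       \<forall>\<epsilon>>0. \<forall>\<mu> \<tau> \<sigma> xs ys.
         \<mu> = m * \<epsilon> \<and> \<tau> = r * \<epsilon> ^ 3 \<and> \<tau> \<le> 1 \<and>
         \<sigma>\<^sub>0 \<le> \<sigma> \<and> \<sigma> \<le> 2 / (Lyy + 2 * \<mu>) \<and>
         cg_rpga X Y gx gy \<mu> (\<lambda>_. \<tau>) (\<lambda>_. \<sigma>) xs ys \<longrightarrow>
         (\<forall>K::nat. real K \<ge> C / \<epsilon> ^ 4 \<longrightarrow>
           (\<exists>t\<in>{nat \<lceil>real K / 2\<rceil>..K - 1}. xs t \<in> X \<and> ys t \<in> Y \<and>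
              gap_Z X Y gx gy \<sigma> (xs t) (ys t) \<le> \<epsilon> \<and>
              approx_game_stationary X Y gx gy \<epsilon> (D * \<epsilon>) (xs t) (ys t) \<and>
              (\<forall>\<rho>>0. cball (xs t) \<rho> \<subseteq> X \<longrightarrow>
                 game_stationary X Y gx gy ((D + 1 / \<rho>) * \<epsilon>) (xs t) (ys t))))"
        proof (rule exI[of _ "?C r"], rule conjI, use C r in blast, rule exI[of _ 1], rule conjI, simp,
            intro allI impI)
          fix \<epsilon> \<mu> \<tau> \<sigma> xs ys and K :: nat
          assume \<epsilon>: "0 < \<epsilon>"
            and h: "\<mu> = m * \<epsilon> \<and> \<tau> = r * \<epsilon> ^ 3 \<and> \<tau> \<le> 1 \<and>
              \<sigma>\<^sub>0 \<le> \<sigma> \<and> \<sigma> \<le> 2 / (Lyy + 2 * \<mu>) \<and>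
              cg_rpga X Y gx gy \<mu> (\<lambda>_. \<tau>) (\<lambda>_. \<sigma>) xs ys"
            and K: "real K \<ge> ?C r / \<epsilon> ^ 4"
          show "\<exists>t\<in>{nat \<lceil>real K / 2\<rceil>..K - 1}. xs t \<in> X \<and> ys t \<in> Y \<and>
              gap_Z X Y gx gy \<sigma> (xs t) (ys t) \<le> \<epsilon> \<and>
              approx_game_stationary X Y gx gy \<epsilon> (1 * \<epsilon>) (xs t) (ys t) \<and>
              (\<forall>\<rho>>0. cball (xs t) \<rho> \<subseteq> X \<longrightarrow>
                 game_stationary X Y gx gy ((1 + 1 / \<rho>) * \<epsilon>) (xs t) (ys t))"
            by (rule main[OF _ _ _ _ \<epsilon> h K]) (use m r in auto)
        qed
      qed
    qed
  qed
qed

end
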